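(* Let $\mathcal H$ be a graded connected Hopf algebra over $\mathbb R$, and $\tau:\mathcal H\to\mathcal H$ a linear graded involution that is an algebra morphism and a coalgebra morphism or antimorphism. Fix $a$ even, and let $\tau^+_a=m\circ(\mathrm{id}\otimes\tau\otimes\mathrm{id}\otimes\tau\otimes\cdots\otimes\tau)\circ\Delta^{[a]}$ and $\tau^-_a=m\circ(\tau\otimes\mathrm{id}\otimes\tau\otimes\mathrm{id}\otimes\cdots\otimes\mathrm{id})\circ\Delta^{[a]}$ (with $a$ alternating tensor factors). (i) For $p_1,\dots,p_k\in(\mathrm{Prim}\,\mathcal H)^{\tau}$, $\sum_{\sigma\in\mathfrak S_k}p_{\sigma(1)}\cdots p_{\sigma(k)}$ is an eigenvector of $\tau^+_a$ and of $\tau^-_a$ with eigenvalue $a^k$. (ii) If $\mathcal P$ is a basis of $(\mathrm{Prim}\,\mathcal H)^{\tau}$ totally ordered by $\preceq$, then the vectors in (i), over all choices $p_1\preceq\cdots\preceq p_k$ in $\mathcal P$ (and all $k$), are linearly independent. (iii) If moreover $\mathcal H$ is cocommutative, then for each fixed $k$ the vectors in (ii) with that $k$ form a basis of the eigenspace of eigenvalue $a^k$ for both $\tau^+_a$ and $\tau^-_a$, and there are no generalised eigenvectors for these eigenvalues other than eigenvectors; in other words, the vectors in (ii), over all $k$, form a basis of a complement of the generalised eigenspace of eigenvalue $0$.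
   Context: Graded connected Hopf algebra over $\mathbb R$: $\mathcal H=\bigoplus_n\mathcal H_n$, $\mathcal H_0=\mathbb R\cdot1$, product $m$ (iterated products also denoted $m$), coproduct $\Delta$; $\Delta^{[2]}=\Delta$, $\Delta^{[l]}=(\Delta^{[l-1]}\otimes\mathrm{id})\circ\Delta$. $\mathrm{Prim}\,\mathcal H=\{x:\Delta(x)=1\otimes x+x\otimes1\}$. Algebra morphism: $f(wz)=f(w)f(z)$; coalgebra morphism: $\Delta\circ f=(f\otimes f)\circ\Delta$; coalgebra antimorphism: $\Delta\circ f=(f\otimes f)\circ\mathrm{swap}\circ\Delta$. $V^{\tau}$ is the $1$-eigenspace of $\tau$. $\mathcal H$ is cocommutative if $\Delta(x)$ is invariant under swapping tensor factors. *)

theory Defs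
  imports "HOL-Analysis.Analysis" "HOL-Analysis.Finite_Function_Topology" "HOL-Combinatorics.Permutations"
begin

section \<open>Tensor powers of a real vector space\<close>

text \<open>
  All tensor powers of \<open>V\<close> live in one type, the tensor algebra \<open>T(V)\<close>, which is the direct sum of
  the \<open>V\<close>$^{\otimes n}$: the free vector space on all lists over \<open>V\<close>, modulo linearity in each
  entry. The list \<open>[x\<^sub>1, \<dots>, x\<^sub>n]\<close> represents the pure tensor of \<open>x\<^sub>1, \<dots>, x\<^sub>n\<close>.
\<close>

definition tensor_relations :: "('a::real_vector list \<Rightarrow>\<^sub>0 real) set" where
  "tensor_relations =
     {Poly_Mapping.single (us @ (x + y) # vs) 1 - Poly_Mapping.single (us @ x # vs) 1
        - Poly_Mapping.single (us @ y # vs) 1 | us x y vs. True}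
   \<union> {Poly_Mapping.single (us @ (c *\<^sub>R x) # vs) 1 - c *\<^sub>R Poly_Mapping.single (us @ x # vs) 1
        | us c x vs. True}"

definition tensor_eq :: "('a::real_vector list \<Rightarrow>\<^sub>0 real) \<Rightarrow> ('a list \<Rightarrow>\<^sub>0 real) \<Rightarrow> bool" where
  "tensor_eq f g \<longleftrightarrow> f - g \<in> span tensor_relations"

lemma equivp_tensor_eq: "equivp (tensor_eq :: ('a::real_vector list \<Rightarrow>\<^sub>0 real) \<Rightarrow> _)"
  (is "equivp ?E")
proof (rule equivpI)
  show "reflp ?E"
    by (auto simp: reflp_def tensor_eq_def span_zero)
  show "symp ?E"
  proof (rule sympI)
    fix f g :: "'a list \<Rightarrow>\<^sub>0 real"
    assume "tensor_eq f g"
    then have "- (f - g) \<in> span tensor_relations"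
      unfolding tensor_eq_def by (rule span_neg)
    then show "tensor_eq g f" by (simp add: tensor_eq_def)
  qed
  show "transp ?E"
  proof (rule transpI)
    fix f g h :: "'a list \<Rightarrow>\<^sub>0 real"
    assume "tensor_eq f g" "tensor_eq g h"
    then have "(f - g) + (g - h) \<in> span tensor_relations"
      unfolding tensor_eq_def by (rule span_add)
    then show "tensor_eq f h" by (simp add: tensor_eq_def)
  qed
qed

quotient_type (overloaded) 'a tensor_algebra = "'a::real_vector list \<Rightarrow>\<^sub>0 real" / tensor_eq
  by (rule equivp_tensor_eq)

instantiation tensor_algebra :: (real_vector) real_vector
begin

lift_definition zero_tensor_algebra :: "'a tensor_algebra" is 0 .

lift_definition plus_tensor_algebra ::
  "'a tensor_algebra \<Rightarrow> 'a tensor_algebra \<Rightarrow> 'a tensor_algebra" is "(+)"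
  unfolding tensor_eq_def by (metis add_diff_add span_add)

lift_definition uminus_tensor_algebra :: "'a tensor_algebra \<Rightarrow> 'a tensor_algebra" is uminus
  unfolding tensor_eq_def by (metis minus_diff_minus span_neg)

lift_definition minus_tensor_algebra ::
  "'a tensor_algebra \<Rightarrow> 'a tensor_algebra \<Rightarrow> 'a tensor_algebra" is "(-)"
proof -
  fix f g f' g' :: "'a list \<Rightarrow>\<^sub>0 real"
  assume "tensor_eq f g" "tensor_eq f' g'"
  then have "(f - g) - (f' - g') \<in> span tensor_relations"
    unfolding tensor_eq_def by (rule span_diff)
  then show "tensor_eq (f - f') (g - g')"
    unfolding tensor_eq_def by (simp add: algebra_simps)
qed

lift_definition scaleR_tensor_algebra :: "real \<Rightarrow> 'a tensor_algebra \<Rightarrow> 'a tensor_algebra" is scaleR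
  unfolding tensor_eq_def by (metis scaleR_diff_right span_scale)

instance
proof
  have eqI: "f = g \<Longrightarrow> tensor_eq f g" for f g :: "'a list \<Rightarrow>\<^sub>0 real"
    by (simp add: tensor_eq_def span_zero)
  fix x y z :: "'a tensor_algebra" and c d :: real
  show "x + y + z = x + (y + z)" by transfer (simp add: eqI add.assoc)
  show "x + y = y + x" by transfer (simp add: eqI add.commute)
  show "0 + x = x" by transfer (simp add: eqI)
  show "- x + x = 0" by transfer (simp add: eqI)
  show "x - y = x + - y" by transfer (simp add: eqI)
  show "c *\<^sub>R (x + y) = c *\<^sub>R x + c *\<^sub>R y" by transfer (simp add: eqI scaleR_add_right)
  show "(c + d) *\<^sub>R x = c *\<^sub>R x + d *\<^sub>R x" by transfer (simp add: eqI scaleR_add_left)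
  show "c *\<^sub>R d *\<^sub>R x = (c * d) *\<^sub>R x" by transfer (simp add: eqI)
  show "1 *\<^sub>R x = x" by transfer (simp add: eqI)
qed

end

lift_definition pure_tensor :: "'a::real_vector list \<Rightarrow> 'a tensor_algebra"
  is "\<lambda>xs. Poly_Mapping.single xs 1" .

definition tensor_power :: "nat \<Rightarrow> 'a::real_vector tensor_algebra set" where
  "tensor_power n = span (pure_tensor ` {xs. length xs = n})"

definition multilinear :: "('a::real_vector list \<Rightarrow> 'b::real_vector) \<Rightarrow> bool" where
  "multilinear g \<longleftrightarrow> (\<forall>us vs. linear (\<lambda>x. g (us @ x # vs)))"

text \<open>
  The linear map on \<open>T(V)\<close> induced by a multilinear map; only meaningful for multilinear \<open>g\<close>, where
  it does not depend on the chosen representative (see \<open>tensor_lift_pure\<close>, \<open>linear_tensor_lift\<close>).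
\<close>

definition free_extend :: "('b \<Rightarrow> 'c::real_vector) \<Rightarrow> ('b \<Rightarrow>\<^sub>0 real) \<Rightarrow> 'c" where
  "free_extend g f = (\<Sum>xs\<in>Poly_Mapping.keys f. Poly_Mapping.lookup f xs *\<^sub>R g xs)"

definition tensor_lift ::
    "('a::real_vector list \<Rightarrow> 'b::real_vector) \<Rightarrow> 'a tensor_algebra \<Rightarrow> 'b" where
  "tensor_lift g t = free_extend g (rep_tensor_algebra t)"

lemma lookup_scaleR_free:
  "Poly_Mapping.lookup (c *\<^sub>R f) x = c *\<^sub>R Poly_Mapping.lookup f x"
  for f :: "'b \<Rightarrow>\<^sub>0 real"
proof -
  have "finite {i. c *\<^sub>R Poly_Mapping.lookup f i \<noteq> 0}"
    by (rule finite_subset[OF _ finite_lookup[of f]]) auto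
  then show ?thesis
    by (simp add: scaleR_poly_mapping_def)
qed

lemma free_extend_superset:
  assumes "finite A" "Poly_Mapping.keys f \<subseteq> A"
  shows "free_extend g f = (\<Sum>xs\<in>A. Poly_Mapping.lookup f xs *\<^sub>R g xs)"
  unfolding free_extend_def
  by (rule sum.mono_neutral_left) (use assms in \<open>auto simp: in_keys_iff\<close>)

lemma linear_free_extend: "linear (free_extend (g :: 'a \<Rightarrow> _))"
proof (rule linearI)
  fix f h :: "'a \<Rightarrow>\<^sub>0 real" and c :: real
  let ?A = "Poly_Mapping.keys f \<union> Poly_Mapping.keys h"
  have "Poly_Mapping.keys (f + h) \<subseteq> ?A"
    by (rule Poly_Mapping.keys_add)
  then show "free_extend g (f + h) = free_extend g f + free_extend g h"
    by (simp add: free_extend_superset[where A = ?A] lookup_add scaleR_add_left sum.distrib)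
  have "Poly_Mapping.keys (c *\<^sub>R f) \<subseteq> Poly_Mapping.keys f"
    by (auto simp: in_keys_iff lookup_scaleR_free)
  then show "free_extend g (c *\<^sub>R f) = c *\<^sub>R free_extend g f"
    by (simp add: free_extend_superset[where A = "Poly_Mapping.keys f"] lookup_scaleR_free
        scaleR_sum_right)
qed

lemma free_extend_single [simp]: "free_extend g (Poly_Mapping.single xs 1) = g xs"
  by (simp add: free_extend_def)

lemma free_extend_relations:
  assumes "multilinear g" "f \<in> span tensor_relations"
  shows "free_extend g f = 0"
proof -
  interpret L: linear "free_extend g" by (rule linear_free_extend)
  have lin: "linear (\<lambda>x. g (us @ x # vs))" for us vs
    using assms(1) by (simp add: multilinear_def)
  have "free_extend g r = 0" if "r \<in> tensor_relations" for r
    using that unfolding tensor_relations_def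
    by (auto simp: L.diff L.scaleR linear_add[OF lin] linear_scale[OF lin])
  then show ?thesis
    using assms(2) linear_eq_0_on_span[OF linear_free_extend] by blast
qed

lemma tensor_lift_abs:
  assumes "multilinear g"
  shows "tensor_lift g (abs_tensor_algebra f) = free_extend g f"
proof -
  have "tensor_eq (rep_tensor_algebra (abs_tensor_algebra f)) f"
    by (simp add: Quotient3_rel_rep[OF Quotient3_tensor_algebra, symmetric]
        Quotient3_abs_rep[OF Quotient3_tensor_algebra] rep_abs_rsp_left[OF Quotient3_tensor_algebra]
        equivp_reflp[OF equivp_tensor_eq])
  then have "free_extend g (rep_tensor_algebra (abs_tensor_algebra f) - f) = 0"
    unfolding tensor_eq_def by (rule free_extend_relations[OF assms])
  then show ?thesis
    by (simp add: tensor_lift_def linear_diff[OF linear_free_extend])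
qed

lemma tensor_lift_pure: "multilinear g \<Longrightarrow> tensor_lift g (pure_tensor xs) = g xs"
  by (simp add: pure_tensor.abs_eq tensor_lift_abs)

lemma linear_tensor_lift:
  fixes g :: "'a::real_vector list \<Rightarrow> 'b::real_vector"
  assumes "multilinear g" shows "linear (tensor_lift g)"
proof (rule linearI)
  fix s t :: "'a tensor_algebra" and c :: real
  obtain f h where [simp]: "s = abs_tensor_algebra f" "t = abs_tensor_algebra h"
    by (metis Quotient3_abs_rep Quotient3_tensor_algebra)
  show "tensor_lift g (s + t) = tensor_lift g s + tensor_lift g t"
    by (simp add: plus_tensor_algebra.abs_eq tensor_lift_abs[OF assms]
        linear_add[OF linear_free_extend])
  show "tensor_lift g (c *\<^sub>R s) = c *\<^sub>R tensor_lift g s"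
    by (simp add: scaleR_tensor_algebra.abs_eq tensor_lift_abs[OF assms]
        linear_scale[OF linear_free_extend])
qed

lemma multilinear_pure_tensor:
  "multilinear (pure_tensor :: 'a::real_vector list \<Rightarrow> _)"
proof -
  have "pure_tensor (us @ (x + y) # vs) = pure_tensor (us @ x # vs) + pure_tensor (us @ y # vs)"
    for us vs :: "'a list" and x y
  proof (transfer, unfold tensor_eq_def)
    fix us vs :: "'a list" and x y :: 'a
    have "Poly_Mapping.single (us @ (x + y) # vs) 1 - Poly_Mapping.single (us @ x # vs) 1
        - Poly_Mapping.single (us @ y # vs) 1 \<in> tensor_relations"
      unfolding tensor_relations_def by blast
    then show "Poly_Mapping.single (us @ (x + y) # vs) 1 - (Poly_Mapping.single (us @ x # vs) 1
        + Poly_Mapping.single (us @ y # vs) 1) \<in> span tensor_relations"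
      by (simp add: span_base diff_diff_add)
  qed
  moreover have "pure_tensor (us @ (c *\<^sub>R x) # vs) = c *\<^sub>R pure_tensor (us @ x # vs)"
    for us vs :: "'a list" and c x
  proof (transfer, unfold tensor_eq_def)
    fix us vs :: "'a list" and c :: real and x :: 'a
    have "Poly_Mapping.single (us @ (c *\<^sub>R x) # vs) 1 - c *\<^sub>R Poly_Mapping.single (us @ x # vs) 1
        \<in> tensor_relations"
      unfolding tensor_relations_def by blast
    then show "Poly_Mapping.single (us @ (c *\<^sub>R x) # vs) 1
        - c *\<^sub>R Poly_Mapping.single (us @ x # vs) 1 \<in> span tensor_relations"
      by (rule span_base)
  qed
  ultimately show ?thesis
    by (simp add: multilinear_def linear_iff)
qed

lemma span_pure_tensor: "span (range pure_tensor) = (UNIV :: 'a::real_vector tensor_algebra set)"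
proof -
  have "t \<in> span (range pure_tensor)" for t :: "'a tensor_algebra"
  proof -
    obtain f where t: "t = abs_tensor_algebra f"
      by (metis Quotient3_abs_rep Quotient3_tensor_algebra)
    have "abs_tensor_algebra f \<in> span (range pure_tensor)"
    proof (induction f rule: Poly_Mapping.update_induct)
      case const
      then show ?case by (simp add: zero_tensor_algebra.abs_eq[symmetric] span_zero)
    next
      case (update f xs c)
      have "Poly_Mapping.update xs c f = f + c *\<^sub>R Poly_Mapping.single xs 1"
        by (rule poly_mapping_eqI)
          (use update(1) in \<open>auto simp: lookup_update lookup_add lookup_scaleR_free lookup_single
            when_def in_keys_iff\<close>)
      then have "abs_tensor_algebra (Poly_Mapping.update xs c f)
          = abs_tensor_algebra f + c *\<^sub>R pure_tensor xs"
        by (simp add: plus_tensor_algebra.abs_eq scaleR_tensor_algebra.abs_eq pure_tensor.abs_eq)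
      then show ?case using update(3) by (simp add: span_add span_base span_scale)
    qed
    then show ?thesis by (simp add: t)
  qed
  then show ?thesis by blast
qed

text \<open>The concatenation product, which identifies the tensor product of \<open>V\<close>$^{\otimes i}$ and
  \<open>V\<close>$^{\otimes j}$ with \<open>V\<close>$^{\otimes (i+j)}$.\<close>

definition tensor_mult ::
    "'a::real_vector tensor_algebra \<Rightarrow> 'a tensor_algebra \<Rightarrow> 'a tensor_algebra" where
  "tensor_mult s t = tensor_lift (\<lambda>xs. tensor_lift (\<lambda>ys. pure_tensor (xs @ ys)) t) s"

text \<open>\<open>f \<otimes> g\<close> on \<open>V \<otimes> V\<close>, for \<open>f\<close> and \<open>g\<close> with values in tensor powers of \<open>V\<close>.\<close>

definition tensor_pair ::
    "('a::real_vector \<Rightarrow> 'a tensor_algebra) \<Rightarrow> ('a \<Rightarrow> 'a tensor_algebra)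
      \<Rightarrow> 'a tensor_algebra \<Rightarrow> 'a tensor_algebra" where
  "tensor_pair f g = tensor_lift (\<lambda>xs. case xs of [x, y] \<Rightarrow> tensor_mult (f x) (g y) | _ \<Rightarrow> 0)"

text \<open>\<open>f\<^sub>1 \<otimes> \<dots> \<otimes> f\<^sub>n\<close> on \<open>V\<close>$^{\otimes n}$, for endomorphisms \<open>f\<^sub>i\<close> of \<open>V\<close>.\<close>

definition tensor_map ::
    "('a::real_vector \<Rightarrow> 'a) list \<Rightarrow> 'a tensor_algebra \<Rightarrow> 'a tensor_algebra" where
  "tensor_map fs = tensor_lift (\<lambda>xs.
     if length xs = length fs then pure_tensor (map2 (\<lambda>f x. f x) fs xs) else 0)"

definition tensor_swap :: "'a::real_vector tensor_algebra \<Rightarrow> 'a tensor_algebra" where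
  "tensor_swap = tensor_lift (\<lambda>xs. case xs of [x, y] \<Rightarrow> pure_tensor [y, x] | _ \<Rightarrow> 0)"

definition mult_map :: "'a::real_algebra_1 tensor_algebra \<Rightarrow> 'a" where
  "mult_map = tensor_lift prod_list"

text \<open>The product of the algebra \<open>A \<otimes> A\<close>, without sign:
  \<open>(x \<otimes> y) (x' \<otimes> y') = x x' \<otimes> y y'\<close>.\<close>

definition tensor_square_mult ::
    "'a::real_algebra_1 tensor_algebra \<Rightarrow> 'a tensor_algebra \<Rightarrow> 'a tensor_algebra" where
  "tensor_square_mult s t = tensor_lift (\<lambda>xs. case xs of [x, y] \<Rightarrow>
       tensor_lift (\<lambda>ys. case ys of [x', y'] \<Rightarrow> pure_tensor [x * x', y * y'] | _ \<Rightarrow> 0) t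
     | _ \<Rightarrow> 0) s"

lemma multilinear_pairI:
  assumes "\<And>y. linear (\<lambda>x. f x y)" "\<And>x. linear (f x)"
  shows "multilinear (\<lambda>xs. case xs of [x, y] \<Rightarrow> f x y | _ \<Rightarrow> 0)"
  unfolding multilinear_def
proof (intro allI)
  fix us vs :: "'a list"
  consider "us = []" "\<exists>y. vs = [y]" | "\<exists>x. us = [x]" "vs = []" | "length us + length vs \<noteq> 1"
    by (cases us; cases vs; fastforce)
  then show "linear (\<lambda>x. case us @ x # vs of [x, y] \<Rightarrow> f x y | _ \<Rightarrow> 0)"
  proof cases
    case 3
    then have "(case us @ x # vs of [x, y] \<Rightarrow> f x y | _ \<Rightarrow> 0) = 0" for x
      by (auto split: list.splits simp: append_eq_Cons_conv)
    then show ?thesis by (simp add: linear_zero)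
  qed (use assms in auto)
qed

lemma multilinear_append:
  assumes "multilinear g"
  shows "multilinear (\<lambda>ys. g (xs @ ys))" "multilinear (\<lambda>xs. g (xs @ ys))"
proof -
  have "linear (\<lambda>x. g (xs @ us @ x # vs))" "linear (\<lambda>x. g ((us @ x # vs) @ ys))" for us vs
    using assms[unfolded multilinear_def, rule_format, of "xs @ us" vs]
      assms[unfolded multilinear_def, rule_format, of us "vs @ ys"] by simp_all
  then show "multilinear (\<lambda>ys. g (xs @ ys))" "multilinear (\<lambda>xs. g (xs @ ys))"
    unfolding multilinear_def by blast+
qed

lemma linear_tensor_lift_param:
  assumes "\<And>xs. linear (\<lambda>p. g p xs)"
  shows "linear (\<lambda>p. tensor_lift (g p) t)"
  using assms unfolding tensor_lift_def free_extend_def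
  by (intro linear_compose_sum ballI linear_compose_scale_right)

lemma tensor_mult_pure: "tensor_mult (pure_tensor xs) (pure_tensor ys) = pure_tensor (xs @ ys)"
proof -
  have "tensor_lift (\<lambda>ys. pure_tensor (xs @ ys)) (pure_tensor ys) = pure_tensor (xs @ ys)"
    for xs ys :: "'a list"
    by (intro tensor_lift_pure multilinear_append multilinear_pure_tensor)
  then show ?thesis
    by (simp add: tensor_mult_def tensor_lift_pure multilinear_append multilinear_pure_tensor)
qed

lemma bilinear_tensor_mult:
  fixes s t :: "'a::real_vector tensor_algebra"
  shows "linear (\<lambda>s. tensor_mult s t)" "linear (tensor_mult s)"
proof -
  have "multilinear (\<lambda>xs. tensor_lift (\<lambda>ys. pure_tensor (xs @ ys)) t)"
    unfolding multilinear_def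
  proof (intro allI linear_tensor_lift_param)
    fix us vs xs :: "'a list"
    show "linear (\<lambda>p. pure_tensor ((us @ p # vs) @ xs))"
      using multilinear_pure_tensor[unfolded multilinear_def, rule_format, of us "vs @ xs"] by simp
  qed
  then show "linear (\<lambda>s. tensor_mult s t)"
    unfolding tensor_mult_def by (rule linear_tensor_lift)
  have "linear (tensor_lift (\<lambda>ys. pure_tensor (xs @ ys)))" for xs :: "'a list"
    by (intro linear_tensor_lift multilinear_append multilinear_pure_tensor)
  then show "linear (tensor_mult s)"
    unfolding tensor_mult_def tensor_lift_def[of _ s] free_extend_def
    by (intro linear_compose_sum ballI linear_compose_scale_right) auto
qed

lemma multilinear_tensor_pair:
  assumes "linear f" "linear g"
  shows "multilinear (\<lambda>xs. case xs of [x, y] \<Rightarrow> tensor_mult (f x) (g y) | _ \<Rightarrow> 0)"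
  using linear_compose[OF assms(1) bilinear_tensor_mult(1)]
    linear_compose[OF assms(2) bilinear_tensor_mult(2)]
  unfolding o_def by (rule multilinear_pairI)

lemma tensor_pair_pure:
  assumes "linear f" "linear g"
  shows "tensor_pair f g (pure_tensor [x, y]) = tensor_mult (f x) (g y)"
  by (simp add: tensor_pair_def tensor_lift_pure multilinear_tensor_pair[OF assms])

lemma multilinear_tensor_map:
  assumes "\<And>f. f \<in> set fs \<Longrightarrow> linear f"
  shows "multilinear (\<lambda>xs. if length xs = length fs then pure_tensor (map2 (\<lambda>f x. f x) fs xs) else 0)"
  unfolding multilinear_def
proof (intro allI)
  fix us vs :: "'a list"
  let ?i = "length us"
  show "linear (\<lambda>x. if length (us @ x # vs) = length fs
      then pure_tensor (map2 (\<lambda>f x. f x) fs (us @ x # vs)) else 0)"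
  proof (cases "?i + Suc (length vs) = length fs")
    case True
    then have i: "?i < length fs" by simp
    have "map2 (\<lambda>f x. f x) fs (us @ x # vs)
        = map2 (\<lambda>f x. f x) (take ?i fs) us @ (fs ! ?i) x # map2 (\<lambda>f x. f x) (drop (Suc ?i) fs) vs" for x
      using i by (subst id_take_nth_drop[OF i]) (simp add: zip_append)
    moreover have "linear (fs ! ?i)" using assms i by simp
    ultimately show ?thesis
      using linear_compose[of "fs ! ?i", OF _ multilinear_pure_tensor[unfolded multilinear_def,
        rule_format, of "map2 (\<lambda>f x. f x) (take ?i fs) us" "map2 (\<lambda>f x. f x) (drop (Suc ?i) fs) vs"]]
        True
      by (simp add: o_def)
  next
    case False
    then show ?thesis by (simp add: linear_zero)
  qed
qed

lemma tensor_map_pure: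
  assumes "\<And>f. f \<in> set fs \<Longrightarrow> linear f" "length xs = length fs"
  shows "tensor_map fs (pure_tensor xs) = pure_tensor (map2 (\<lambda>f x. f x) fs xs)"
  by (simp add: tensor_map_def tensor_lift_pure multilinear_tensor_map assms)

lemma linear_pure_tensor_pair:
  "linear (\<lambda>x. pure_tensor [x, y])" "linear (\<lambda>y. pure_tensor [x, y])"
  using multilinear_pure_tensor[unfolded multilinear_def, rule_format, of "[]" "[y]"]
    multilinear_pure_tensor[unfolded multilinear_def, rule_format, of "[x]" "[]"] by simp_all

lemma tensor_swap_pure: "tensor_swap (pure_tensor [x, y]) = pure_tensor [y, x]"
  by (simp add: tensor_swap_def
      tensor_lift_pure[OF multilinear_pairI[OF linear_pure_tensor_pair(2) linear_pure_tensor_pair(1)]])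

lemma multilinear_prod_list: "multilinear (prod_list :: 'a::real_algebra_1 list \<Rightarrow> 'a)"
  by (simp add: multilinear_def linear_iff distrib_left distrib_right)

lemma mult_map_pure: "mult_map (pure_tensor xs) = prod_list xs"
  by (simp add: mult_map_def tensor_lift_pure multilinear_prod_list)

lemma linear_case_pair:
  assumes "\<And>x y. linear (\<lambda>z. F z x y)"
  shows "linear (\<lambda>z. case xs of [x, y] \<Rightarrow> F z x y | _ \<Rightarrow> 0)"
proof (cases "\<exists>x y. xs = [x, y]")
  case True
  then show ?thesis using assms by auto
next
  case False
  then have "(\<lambda>z. case xs of [x, y] \<Rightarrow> F z x y | _ \<Rightarrow> 0) = (\<lambda>z. 0)"
    by (intro ext) (auto split: list.splits)
  then show ?thesis by (simp add: linear_zero)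
qed

lemma tensor_square_mult_pure:
  fixes x y x' y' :: "'a::real_algebra_1"
  shows "tensor_square_mult (pure_tensor [x, y]) (pure_tensor [x', y']) = pure_tensor [x * x', y * y']"
proof -
  have m: "linear (\<lambda>z. a * z)" "linear (\<lambda>z. z * a)" for a :: 'a
    by (simp_all add: linear_iff distrib_left distrib_right)
  have l: "linear (\<lambda>z. pure_tensor [a * z, b])" "linear (\<lambda>z. pure_tensor [b, a * z])"
    "linear (\<lambda>z. pure_tensor [z * a, b])" "linear (\<lambda>z. pure_tensor [b, z * a])" for a b :: 'a
    using linear_compose[OF m(1) linear_pure_tensor_pair(1)]
      linear_compose[OF m(1) linear_pure_tensor_pair(2)]
      linear_compose[OF m(2) linear_pure_tensor_pair(1)]
      linear_compose[OF m(2) linear_pure_tensor_pair(2)]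
    by (simp_all add: o_def)
  have inner: "multilinear (\<lambda>ys. case ys of [x', y'] \<Rightarrow> pure_tensor [x * x', y * y'] | _ \<Rightarrow> 0)"
    by (intro multilinear_pairI l)
  have outer: "multilinear (\<lambda>xs. case xs of [x, y] \<Rightarrow>
       tensor_lift (\<lambda>ys. case ys of [x', y'] \<Rightarrow> pure_tensor [x * x', y * y'] | _ \<Rightarrow> 0) t
     | _ \<Rightarrow> 0)" for t :: "'a tensor_algebra"
    by (intro multilinear_pairI linear_tensor_lift_param linear_case_pair l)
  show ?thesis
    by (simp add: tensor_square_mult_def tensor_lift_pure[OF outer] tensor_lift_pure[OF inner])
qed


section \<open>Graded connected Hopf algebras\<close>

locale real_coalgebra =
  fixes \<Delta> :: "'a::real_vector \<Rightarrow> 'a tensor_algebra"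
    and \<epsilon> :: "'a \<Rightarrow> real"
  assumes linear_coproduct: "linear \<Delta>"
    and coproduct_range: "\<Delta> x \<in> tensor_power 2"
    and coassociative:
      "tensor_pair \<Delta> (\<lambda>y. pure_tensor [y]) (\<Delta> x) = tensor_pair (\<lambda>y. pure_tensor [y]) \<Delta> (\<Delta> x)"
    and linear_counit: "linear \<epsilon>"
    and counit_left: "tensor_lift (\<lambda>xs. case xs of [y, z] \<Rightarrow> \<epsilon> y *\<^sub>R z | _ \<Rightarrow> 0) (\<Delta> x) = x"
    and counit_right: "tensor_lift (\<lambda>xs. case xs of [y, z] \<Rightarrow> \<epsilon> z *\<^sub>R y | _ \<Rightarrow> 0) (\<Delta> x) = x"

locale real_bialgebra = real_coalgebra \<Delta> \<epsilon>
  for \<Delta> :: "'a::real_algebra_1 \<Rightarrow> 'a tensor_algebra" and \<epsilon> :: "'a \<Rightarrow> real" +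
  assumes coproduct_mult: "\<Delta> (x * y) = tensor_square_mult (\<Delta> x) (\<Delta> y)"
    and coproduct_one: "\<Delta> 1 = pure_tensor [1, 1]"
    and counit_mult: "\<epsilon> (x * y) = \<epsilon> x * \<epsilon> y"
    and counit_one: "\<epsilon> 1 = 1"

locale real_hopf_algebra = real_bialgebra \<Delta> \<epsilon>
  for \<Delta> :: "'a::real_algebra_1 \<Rightarrow> 'a tensor_algebra" and \<epsilon> :: "'a \<Rightarrow> real" +
  fixes S :: "'a \<Rightarrow> 'a"
  assumes linear_antipode: "linear S"
    and antipode_left: "mult_map (tensor_map [S, id] (\<Delta> x)) = \<epsilon> x *\<^sub>R 1"
    and antipode_right: "mult_map (tensor_map [id, S] (\<Delta> x)) = \<epsilon> x *\<^sub>R 1"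

definition is_direct_sum :: "(nat \<Rightarrow> 'a::real_vector set) \<Rightarrow> bool" where
  "is_direct_sum H \<longleftrightarrow> (\<forall>n. subspace (H n)) \<and>
     (\<forall>x. \<exists>!c. finite {n. c n \<noteq> 0} \<and> (\<forall>n. c n \<in> H n) \<and> x = (\<Sum>n | c n \<noteq> 0. c n))"

locale graded_connected_hopf_algebra = real_hopf_algebra \<Delta> \<epsilon> S
  for \<Delta> :: "'a::real_algebra_1 \<Rightarrow> 'a tensor_algebra" and \<epsilon> :: "'a \<Rightarrow> real" and S :: "'a \<Rightarrow> 'a" +
  fixes H :: "nat \<Rightarrow> 'a set"
  assumes grading: "is_direct_sum H"
    and connected: "H 0 = span {1}"
    and graded_mult: "x \<in> H i \<Longrightarrow> y \<in> H j \<Longrightarrow> x * y \<in> H (i + j)"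
    and graded_coproduct:
      "x \<in> H n \<Longrightarrow> \<Delta> x \<in> span {pure_tensor [y, z] | y z i j. i + j = n \<and> y \<in> H i \<and> z \<in> H j}"
    and graded_counit: "x \<in> H n \<Longrightarrow> 0 < n \<Longrightarrow> \<epsilon> x = 0"
    and graded_antipode: "x \<in> H n \<Longrightarrow> S x \<in> H n"

definition coalgebra_morphism ::
    "('a::real_vector \<Rightarrow> 'a tensor_algebra) \<Rightarrow> ('a \<Rightarrow> 'a) \<Rightarrow> bool" where
  "coalgebra_morphism \<Delta> f \<longleftrightarrow> (\<forall>x. \<Delta> (f x) = tensor_map [f, f] (\<Delta> x))"

definition coalgebra_antimorphism ::
    "('a::real_vector \<Rightarrow> 'a tensor_algebra) \<Rightarrow> ('a \<Rightarrow> 'a) \<Rightarrow> bool" where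
  "coalgebra_antimorphism \<Delta> f \<longleftrightarrow> (\<forall>x. \<Delta> (f x) = tensor_map [f, f] (tensor_swap (\<Delta> x)))"

definition cocommutative :: "('a::real_vector \<Rightarrow> 'a tensor_algebra) \<Rightarrow> bool" where
  "cocommutative \<Delta> \<longleftrightarrow> (\<forall>x. tensor_swap (\<Delta> x) = \<Delta> x)"

definition primitives :: "('a::real_algebra_1 \<Rightarrow> 'a tensor_algebra) \<Rightarrow> 'a set" where
  "primitives \<Delta> = {x. \<Delta> x = pure_tensor [1, x] + pure_tensor [x, 1]}"

text \<open>The iterated coproduct starts at \<open>l = 2\<close>; its values for \<open>l < 2\<close> are unspecified.\<close>

fun iterated_coproduct ::
    "('a::real_vector \<Rightarrow> 'a tensor_algebra) \<Rightarrow> nat \<Rightarrow> 'a \<Rightarrow> 'a tensor_algebra" where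
  "iterated_coproduct \<Delta> (Suc (Suc 0)) x = \<Delta> x"
| "iterated_coproduct \<Delta> (Suc (Suc (Suc l))) x =
     tensor_pair (iterated_coproduct \<Delta> (Suc (Suc l))) (\<lambda>y. pure_tensor [y]) (\<Delta> x)"

definition tau_plus ::
    "('a::real_algebra_1 \<Rightarrow> 'a tensor_algebra) \<Rightarrow> ('a \<Rightarrow> 'a) \<Rightarrow> nat \<Rightarrow> 'a \<Rightarrow> 'a" where
  "tau_plus \<Delta> \<tau> a =
     mult_map \<circ> tensor_map (map (\<lambda>i. if even i then id else \<tau>) [0..<a]) \<circ> iterated_coproduct \<Delta> a"

definition tau_minus ::
    "('a::real_algebra_1 \<Rightarrow> 'a tensor_algebra) \<Rightarrow> ('a \<Rightarrow> 'a) \<Rightarrow> nat \<Rightarrow> 'a \<Rightarrow> 'a" where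
  "tau_minus \<Delta> \<tau> a =
     mult_map \<circ> tensor_map (map (\<lambda>i. if even i then \<tau> else id) [0..<a]) \<circ> iterated_coproduct \<Delta> a"


section \<open>Eigenspaces, bases and symmetrised products\<close>

definition eigenspace :: "('a::real_vector \<Rightarrow> 'a) \<Rightarrow> real \<Rightarrow> 'a set" where
  "eigenspace T c = {x. T x = c *\<^sub>R x}"

definition generalised_eigenspace :: "('a::real_vector \<Rightarrow> 'a) \<Rightarrow> real \<Rightarrow> 'a set" where
  "generalised_eigenspace T c = {x. \<exists>n. ((\<lambda>y. T y - c *\<^sub>R y) ^^ n) x = 0}"

definition basis_of :: "'a::real_vector set \<Rightarrow> 'a set \<Rightarrow> bool" where
  "basis_of B V \<longleftrightarrow> independent B \<and> span B = V"

definition complementary :: "'a::real_vector set \<Rightarrow> 'a set \<Rightarrow> bool" where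
  "complementary V W \<longleftrightarrow> subspace V \<and> subspace W \<and> V \<inter> W = {0} \<and>
     (\<forall>x. \<exists>v\<in>V. \<exists>w\<in>W. x = v + w)"

definition sym_product :: "'a::real_algebra_1 list \<Rightarrow> 'a" where
  "sym_product ps = (\<Sum>\<sigma> | \<sigma> permutes {..<length ps}.
     prod_list (map (\<lambda>i. ps ! \<sigma> i) [0..<length ps]))"

definition ordered_lists :: "'a set \<Rightarrow> 'a rel \<Rightarrow> 'a list set" where
  "ordered_lists P r = {ps. set ps \<subseteq> P \<and> sorted_wrt (\<lambda>x y. (x, y) \<in> r) ps}"

end

theory Submission
  imports Defs "HOL-Computational_Algebra.Polynomial"
begin

text \<open>
  By polarisation, symmetrised products are combinations of powers \<open>p ^ k\<close> of invariant primitives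
  \<open>p\<close>. On these every tensor slot acts as the identity, so the binomial formula for the coproduct of
  \<open>p ^ k\<close> gives the eigenvalue \<open>a ^ k\<close>. Linear independence follows by pairing with convolution
  products of linear functionals.

  In the cocommutative case \<open>H\<close> is generated by its primitives, because the convolution logarithm of
  the identity has primitive values and differs from the identity by products of elements of lower
  degree. Modulo shorter products, both operators multiply a product of primitive \<open>\<tau>\<close>-eigenvectors
  by \<open>a\<close> for each invariant factor and by \<open>0\<close> for each anti-invariant one. By induction on the length,
  \<open>H\<close> is the sum of the span of the symmetrised products of invariant primitives and the generalised
  \<open>0\<close>-eigenspace; as the eigenvalues \<open>a ^ k\<close> are distinct and nonzero, this sum is direct and determines
  all eigenspaces in question.
\<close>

section \<open>Linearity of the tensor operations\<close>

text \<open>The spectral part rests instead on one closure property: a vector lies in the sum of the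
  eigenvector span and the generalised 0-eigenspace as soon as its image does. This is what handles
  products with an anti-invariant factor, whose leading scalar is 0. That scalar is 0 because
  \<open>a\<close> is even: half of the slots carry the identity, half carry \<tau>, and their signs
  on an anti-invariant primitive cancel.

  The operators separate symmetrised products of different lengths only, so independence within one
  length needs functionals. Whether \<tau> is a morphism or an antimorphism of coalgebras makes no
  difference on primitives, whose coproduct is symmetric. Tensors are replaced early by bilinear
  maps summed over the coproduct, which turns each coalgebra axiom into an identity of such
  sums.\<close>

lemma linear_left_mult: "linear f \<Longrightarrow> linear (\<lambda>x. c * f x :: 'b::real_algebra)"
  and linear_right_mult: "linear f \<Longrightarrow> linear (\<lambda>x. f x * c :: 'b::real_algebra)"
  by (simp_all add: linear_iff distrib_left distrib_right)

lemma linear_scaleR_vector: "linear f \<Longrightarrow> linear (\<lambda>x. f x *\<^sub>R c)"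
  by (simp add: linear_iff scaleR_add_left)

lemma linear_pure_tensor_pair_compose:
  assumes "linear f"
  shows "linear (\<lambda>x. pure_tensor [f x, y])" "linear (\<lambda>x. pure_tensor [y, f x])"
  using linear_compose[OF assms linear_pure_tensor_pair(1)]
    linear_compose[OF assms linear_pure_tensor_pair(2)] by (simp_all add: o_def)

lemmas linear_intros = linear_left_mult linear_right_mult linear_scaleR_vector linear_ident
  linear_compose_scale_right linear_compose_add linear_compose_sub linear_zero
  linear_pure_tensor_pair_compose

lemma multilinear_tripleI:
  assumes "\<And>y z. linear (\<lambda>x. f x y z)" "\<And>x z. linear (\<lambda>y. f x y z)" "\<And>x y. linear (f x y)"
  shows "multilinear (\<lambda>xs. case xs of [x, y, z] \<Rightarrow> f x y z | _ \<Rightarrow> 0)"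
  unfolding multilinear_def
proof (intro allI)
  fix us vs :: "'a list"
  consider "us = []" "\<exists>y z. vs = [y, z]" | "\<exists>x. us = [x]" "\<exists>z. vs = [z]"
    | "\<exists>x y. us = [x, y]" "vs = []" | "length us + length vs \<noteq> 2"
    by (cases us; cases vs; cases "tl us"; cases "tl vs"; fastforce)
  then show "linear (\<lambda>x. case us @ x # vs of [x, y, z] \<Rightarrow> f x y z | _ \<Rightarrow> 0)"
  proof cases
    case 4
    then have "(case us @ x # vs of [x, y, z] \<Rightarrow> f x y z | _ \<Rightarrow> 0) = 0" for x
      by (auto split: list.splits simp: append_eq_Cons_conv)
    then show ?thesis by (simp add: linear_zero)
  qed (use assms in auto)
qed

lemma tensor_eq_on_pure:
  assumes "linear f" "linear g" "\<And>xs. f (pure_tensor xs) = g (pure_tensor xs)"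
  shows "f t = g t"
  using linear_eq_on_span[OF assms(1,2), of "range pure_tensor" t] assms(3) span_pure_tensor
  by auto

lemma linear_tensor_square_mult:
  fixes s t :: "'a::real_algebra_1 tensor_algebra"
  shows "linear (\<lambda>s. tensor_square_mult s t)" "linear (tensor_square_mult s)"
proof -
  show "linear (\<lambda>s. tensor_square_mult s t)"
    unfolding tensor_square_mult_def
    by (intro linear_tensor_lift multilinear_pairI linear_tensor_lift_param linear_case_pair
        linear_intros)
  have "linear (\<lambda>t. case xs of [x, y] \<Rightarrow>
       tensor_lift (\<lambda>ys. case ys of [x', y'] \<Rightarrow> pure_tensor [x * x', y * y'] | _ \<Rightarrow> 0) t
     | _ \<Rightarrow> 0)" for xs :: "'a list"
    by (intro linear_case_pair linear_tensor_lift multilinear_pairI linear_intros)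
  then show "linear (tensor_square_mult s)"
    unfolding tensor_square_mult_def by (rule linear_tensor_lift_param)
qed

lemma linear_tensor_pair: "linear f \<Longrightarrow> linear g \<Longrightarrow> linear (tensor_pair f g)"
  unfolding tensor_pair_def by (intro linear_tensor_lift multilinear_tensor_pair)

lemma linear_tensor_map: "(\<And>f. f \<in> set fs \<Longrightarrow> linear f) \<Longrightarrow> linear (tensor_map fs)"
  unfolding tensor_map_def by (intro linear_tensor_lift multilinear_tensor_map)

lemma linear_mult_map: "linear mult_map"
  unfolding mult_map_def by (intro linear_tensor_lift multilinear_prod_list)

lemma linear_tensor_swap: "linear tensor_swap"
  unfolding tensor_swap_def by (intro linear_tensor_lift multilinear_pairI linear_intros)

lemma linear_pure_tensor_single: "linear (\<lambda>x. pure_tensor [x])"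
  using multilinear_pure_tensor[unfolded multilinear_def, rule_format, of "[]" "[]"] by simp

lemma linear_compose_lambda: "linear f \<Longrightarrow> linear g \<Longrightarrow> linear (\<lambda>x. f (g x))"
  using linear_compose[of g f] by (simp add: o_def)

lemma bilinearI: "(\<And>y. linear (\<lambda>x. B x y)) \<Longrightarrow> (\<And>x. linear (\<lambda>y. B x y)) \<Longrightarrow> bilinear B"
  by (simp add: bilinear_def)

section \<open>Sweedler sums\<close>

context real_coalgebra
begin

text \<open>\<open>sw B x\<close> is the sum of \<open>B x\<^sub>1 x\<^sub>2\<close> in Sweedler notation.\<close>

definition sw :: "('a \<Rightarrow> 'a \<Rightarrow> 'b::real_vector) \<Rightarrow> 'a \<Rightarrow> 'b" where
  "sw B x = tensor_lift (\<lambda>xs. case xs of [y, z] \<Rightarrow> B y z | _ \<Rightarrow> 0) (\<Delta> x)"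

text \<open>By \<open>coproduct_range\<close>, \<Delta> x is a combination of pure tensors of length
  two, so a linear map on it is determined by its values on pairs. This converts statements about
  \<Delta> into statements about \<open>sw\<close>.\<close>

lemma linear_coproduct_eq_sw:
  assumes L: "linear L"
  shows "L (\<Delta> x) = sw (\<lambda>y z. L (pure_tensor [y, z])) x"
proof -
  let ?B = "\<lambda>xs. case xs of [y, z] \<Rightarrow> L (pure_tensor [y, z]) | _ \<Rightarrow> 0"
  have m: "multilinear ?B"
    by (intro multilinear_pairI linear_compose_lambda[OF L] linear_intros)
  have "L t = tensor_lift ?B t" if "t \<in> pure_tensor ` {xs. length xs = 2}" for t
    using that m by (auto simp: tensor_lift_pure length_Suc_conv numeral_2_eq_2)
  then show ?thesis
    using linear_eq_on_span[OF L linear_tensor_lift[OF m]] coproduct_range[of x]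
    unfolding sw_def tensor_power_def by blast
qed

lemma linear_sw: "bilinear B \<Longrightarrow> linear (sw B)"
  unfolding sw_def bilinear_def
  by (intro linear_compose_lambda[OF linear_tensor_lift linear_coproduct] multilinear_pairI) auto

lemma linear_sw_param: "(\<And>y z. linear (\<lambda>p. B p y z)) \<Longrightarrow> linear (\<lambda>p. sw (B p) x)"
  unfolding sw_def by (intro linear_tensor_lift_param linear_case_pair) auto

lemma linear_apply_sw:
  assumes "linear f" "bilinear B"
  shows "f (sw B x) = sw (\<lambda>y z. f (B y z)) x"
proof -
  let ?B = "\<lambda>xs. case xs of [y, z] \<Rightarrow> B y z | _ \<Rightarrow> 0"
  have m: "multilinear ?B"
    using assms(2) by (intro multilinear_pairI) (auto simp: bilinear_def)
  have "f (tensor_lift ?B (\<Delta> x)) = sw (\<lambda>y z. f (tensor_lift ?B (pure_tensor [y, z]))) x"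
    by (rule linear_coproduct_eq_sw) (intro linear_compose_lambda[OF assms(1)] linear_tensor_lift m)
  then show ?thesis
    by (simp add: tensor_lift_pure[OF m] flip: sw_def)
qed

lemma sw_add: "sw (\<lambda>y z. A y z + B y z) x = sw A x + sw B x"
  unfolding sw_def tensor_lift_def free_extend_def
  by (auto simp flip: sum.distrib scaleR_add_right intro!: sum.cong split: list.splits)

lemma sw_sum: "sw (\<lambda>y z. \<Sum>i\<in>I. B i y z) x = (\<Sum>i\<in>I. sw (B i) x)"
proof -
  have "(case xs of [y, z] \<Rightarrow> \<Sum>i\<in>I. B i y z | _ \<Rightarrow> 0) = (\<Sum>i\<in>I. case xs of [y, z] \<Rightarrow> B i y z | _ \<Rightarrow> 0)"
    for xs :: "'a list"
    by (auto split: list.splits)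
  then show ?thesis
    unfolding sw_def tensor_lift_def free_extend_def
    by (simp add: scaleR_sum_right sum.swap[of _ I])
qed

lemma sw_scaleR: "sw (\<lambda>y z. c *\<^sub>R B y z) x = c *\<^sub>R sw B x"
  unfolding sw_def tensor_lift_def free_extend_def
  by (auto simp: scaleR_sum_right intro!: sum.cong split: list.splits)

text \<open>The linear map induced by \<open>G\<close> on triple tensors is applied to both sides of
  \<open>coassociative\<close>.\<close>

lemma sw_coassoc:
  assumes G: "\<And>y z. linear (\<lambda>x. G x y z)" "\<And>x z. linear (\<lambda>y. G x y z)" "\<And>x y. linear (G x y)"
  shows "sw (\<lambda>u z. sw (\<lambda>x y. G x y z) u) w = sw (\<lambda>x v. sw (\<lambda>y z. G x y z) v) w"
proof -
  let ?g = "\<lambda>xs. case xs of [x, y, z] \<Rightarrow> G x y z | _ \<Rightarrow> 0"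
  have m: "multilinear ?g" by (intro multilinear_tripleI G)
  let ?L = "tensor_lift ?g"
  note L = linear_tensor_lift[OF m]
  note single = linear_pure_tensor_single
  have left: "?L (tensor_mult (\<Delta> u) (pure_tensor [z])) = sw (\<lambda>x y. G x y z) u" for u z
    by (subst linear_coproduct_eq_sw[where L = "\<lambda>s. ?L (tensor_mult s (pure_tensor [z]))"])
      (auto intro!: linear_compose_lambda[OF L] bilinear_tensor_mult
        simp: tensor_mult_pure tensor_lift_pure[OF m])
  have right: "?L (tensor_mult (pure_tensor [x]) (\<Delta> v)) = sw (\<lambda>y z. G x y z) v" for x v
    by (subst linear_coproduct_eq_sw[where L = "\<lambda>s. ?L (tensor_mult (pure_tensor [x]) s)"])
      (auto intro!: linear_compose_lambda[OF L] bilinear_tensor_mult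
        simp: tensor_mult_pure tensor_lift_pure[OF m])
  have pair: "?L (tensor_pair f g (\<Delta> w)) = sw (\<lambda>y z. ?L (tensor_mult (f y) (g z))) w"
    if "linear f" "linear g" for f g
    by (subst linear_coproduct_eq_sw[where L = "\<lambda>s. ?L (tensor_pair f g s)"])
      (auto intro!: linear_compose_lambda[OF L] linear_tensor_pair that simp: tensor_pair_pure that)
  show ?thesis
    using pair[OF linear_coproduct single] pair[OF single linear_coproduct]
    unfolding left right coassociative by simp
qed

lemma sw_counit_left:
  assumes "linear f" shows "sw (\<lambda>y z. \<epsilon> y *\<^sub>R f z) x = f x"
proof -
  have "bilinear (\<lambda>y z. \<epsilon> y *\<^sub>R z)"
    by (intro bilinearI linear_intros linear_counit)
  from linear_apply_sw[OF assms this, of x] show ?thesis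
    using counit_left[of x] by (simp add: linear_scale[OF assms] sw_def)
qed

lemma sw_counit_right:
  assumes "linear f" shows "sw (\<lambda>y z. \<epsilon> z *\<^sub>R f y) x = f x"
proof -
  have "bilinear (\<lambda>y z. \<epsilon> z *\<^sub>R y)"
    by (intro bilinearI linear_intros linear_counit)
  from linear_apply_sw[OF assms this, of x] show ?thesis
    using counit_right[of x] by (simp add: linear_scale[OF assms] sw_def)
qed

lemma coproduct_eq_sw: "\<Delta> x = sw (\<lambda>y z. pure_tensor [y, z]) x"
  using linear_coproduct_eq_sw[of "\<lambda>t. t"] by (simp add: linear_intros)

lemma linear_tensor_lift_bilinear:
  "bilinear B \<Longrightarrow> linear (tensor_lift (\<lambda>xs. case xs of [y, z] \<Rightarrow> B y z | _ \<Rightarrow> 0))"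
  by (intro linear_tensor_lift multilinear_pairI) (auto simp: bilinear_def)

lemma tensor_lift_bilinear_pure:
  "bilinear B \<Longrightarrow> tensor_lift (\<lambda>xs. case xs of [y, z] \<Rightarrow> B y z | _ \<Rightarrow> 0) (pure_tensor [x, y]) = B x y"
  by (subst tensor_lift_pure) (auto simp: bilinear_def intro!: multilinear_pairI)

lemma sw_swap:
  assumes "cocommutative \<Delta>" "bilinear B"
  shows "sw (\<lambda>y z. B z y) x = sw B x"
proof -
  let ?L = "tensor_lift (\<lambda>xs. case xs of [y, z] \<Rightarrow> B y z | _ \<Rightarrow> 0)"
  have "sw B x = ?L (tensor_swap (\<Delta> x))"
    using assms(1) by (simp add: cocommutative_def sw_def)
  also have "\<dots> = sw (\<lambda>y z. ?L (tensor_swap (pure_tensor [y, z]))) x"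
    by (rule linear_coproduct_eq_sw[where L = "\<lambda>s. ?L (tensor_swap s)"])
      (intro linear_compose_lambda[OF linear_tensor_lift_bilinear] linear_tensor_swap assms(2))
  also have "\<dots> = sw (\<lambda>y z. B z y) x"
    by (simp add: tensor_swap_pure tensor_lift_bilinear_pure[OF assms(2)])
  finally show ?thesis by simp
qed

text \<open>Coassociativity rebrackets the four legs so that the two inner ones come from a single
  coproduct, where cocommutativity may exchange them.\<close>

lemma sw_swap_middle:
  assumes cc: "cocommutative \<Delta>"
    and G: "\<And>b c d. linear (\<lambda>a. G a b c d)" "\<And>a c d. linear (\<lambda>b. G a b c d)"
      "\<And>a b d. linear (\<lambda>c. G a b c d)" "\<And>a b c. linear (\<lambda>d. G a b c d)"
  shows "sw (\<lambda>u v. sw (\<lambda>a b. sw (\<lambda>c d. G a b c d) v) u) x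
       = sw (\<lambda>u v. sw (\<lambda>a b. sw (\<lambda>c d. G a c b d) v) u) x"
proof -
  have lin: "linear (sw (\<lambda>c d. K c d))" if "\<And>d. linear (\<lambda>c. K c d)" "\<And>c. linear (K c)"
    for K :: "'a \<Rightarrow> 'a \<Rightarrow> 'b"
    using that by (intro linear_sw bilinearI) auto
  have assoc: "sw (\<lambda>u v. sw (\<lambda>a b. sw (\<lambda>c d. K a b c d) v) u) x
      = sw (\<lambda>a w. sw (\<lambda>u d. sw (\<lambda>b c. K a b c d) u) w) x"
    if K: "\<And>b c d. linear (\<lambda>a. K a b c d)" "\<And>a c d. linear (\<lambda>b. K a b c d)"
      "\<And>a b d. linear (\<lambda>c. K a b c d)" "\<And>a b c. linear (\<lambda>d. K a b c d)"
    for K :: "'a \<Rightarrow> 'a \<Rightarrow> 'a \<Rightarrow> 'a \<Rightarrow> 'b"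
  proof -
    have "sw (\<lambda>u v. sw (\<lambda>a b. sw (\<lambda>c d. K a b c d) v) u) x
        = sw (\<lambda>a w. sw (\<lambda>b v. sw (\<lambda>c d. K a b c d) v) w) x"
      by (rule sw_coassoc) (intro linear_sw_param lin K)+
    also have "\<dots> = sw (\<lambda>a w. sw (\<lambda>u d. sw (\<lambda>b c. K a b c d) u) w) x"
      by (subst sw_coassoc) (auto intro: K)
    finally show ?thesis .
  qed
  have "sw (\<lambda>b c. G a b c d) u = sw (\<lambda>b c. G a c b d) u" for a d u
    by (rule sw_swap[OF cc, symmetric]) (intro bilinearI G)
  then show ?thesis
    by (simp add: assoc G)
qed

section \<open>Convolution and the iterated coproduct\<close>

definition conv :: "('a \<Rightarrow> 'b) \<Rightarrow> ('a \<Rightarrow> 'b) \<Rightarrow> 'a \<Rightarrow> 'b::real_algebra_1" where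
  "conv f g = sw (\<lambda>y z. f y * g z)"

lemma bilinear_conv: "linear f \<Longrightarrow> linear g \<Longrightarrow> bilinear (\<lambda>y z. f y * g z :: 'b::real_algebra_1)"
  by (intro bilinearI linear_intros) auto

lemma linear_conv: "linear f \<Longrightarrow> linear g \<Longrightarrow> linear (conv f g)"
  unfolding conv_def by (intro linear_sw bilinear_conv)

lemma conv_add_right: "conv f (\<lambda>x. g x + h x) = (\<lambda>x. conv f g x + conv f h x)"
  unfolding conv_def by (auto simp: distrib_left sw_add bilinear_conv)

lemma conv_counit_right: "linear f \<Longrightarrow> conv f (\<lambda>x. \<epsilon> x *\<^sub>R 1) = f"
  unfolding conv_def using sw_counit_right by auto

lemma tensor_map_coproduct:
  assumes "linear f" "linear g"
  shows "tensor_map [f, g] (\<Delta> x) = sw (\<lambda>y z. pure_tensor [f y, g z]) x"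
proof -
  have lin: "h \<in> set [f, g] \<Longrightarrow> linear h" for h
    using assms by auto
  then have "tensor_map [f, g] (pure_tensor [y, z]) = pure_tensor [f y, g z]" for y z
    using tensor_map_pure[of "[f, g]" "[y, z]"] by simp
  then show ?thesis
    using linear_coproduct_eq_sw[OF linear_tensor_map, of "[f, g]" x] lin by simp
qed

lemma linear_iterated_coproduct: "linear (iterated_coproduct \<Delta> (Suc (Suc n)))"
proof (induction n)
  case 0
  then show ?case using linear_coproduct by (simp add: fun_eq_iff[symmetric] cong: if_cong)
next
  case (Suc n)
  have "iterated_coproduct \<Delta> (Suc (Suc (Suc n))) =
    (\<lambda>x. tensor_pair (iterated_coproduct \<Delta> (Suc (Suc n))) (\<lambda>y. pure_tensor [y]) (\<Delta> x))" by auto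
  then show ?case
    using Suc by (auto intro!: linear_compose_lambda[OF linear_tensor_pair] linear_coproduct linear_pure_tensor_single)
qed

end

text \<open>Matches the recursion of \<open>iterated_coproduct\<close>, which adds slots at the
  right end. On lists whose length differs from that of \<open>fs\<close> both sides are 0, so the
  identity holds on the whole tensor algebra.\<close>

lemma mult_map_tensor_map_snoc:
  fixes s :: "'a::real_algebra_1 tensor_algebra"
  assumes fs: "\<And>h. h \<in> set (fs @ [f]) \<Longrightarrow> linear h"
  shows "mult_map (tensor_map (fs @ [f]) (tensor_mult s (pure_tensor [z]))) = mult_map (tensor_map fs s) * f z"
proof (rule tensor_eq_on_pure[of "\<lambda>s. mult_map (tensor_map (fs @ [f]) (tensor_mult s (pure_tensor [z])))"
      "\<lambda>s. mult_map (tensor_map fs s) * f z"])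
  show "linear (\<lambda>s. mult_map (tensor_map (fs @ [f]) (tensor_mult s (pure_tensor [z]))))"
    using fs by (intro linear_compose_lambda[OF linear_mult_map] linear_compose_lambda[OF linear_tensor_map]
      bilinear_tensor_mult) auto
  show "linear (\<lambda>s. mult_map (tensor_map fs s) * f z)"
    using fs by (intro linear_intros linear_compose_lambda[OF linear_mult_map] linear_tensor_map) auto
  fix xs :: "'a list"
  have m: "multilinear (\<lambda>xs. if length xs = length fs then pure_tensor (map2 (\<lambda>f x. f x) fs xs) else 0)"
    "multilinear (\<lambda>xs. if length xs = length (fs @ [f]) then pure_tensor (map2 (\<lambda>f x. f x) (fs @ [f]) xs) else 0)"
    using fs by (intro multilinear_tensor_map; simp)+
  show "mult_map (tensor_map (fs @ [f]) (tensor_mult (pure_tensor xs) (pure_tensor [z])))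
     = mult_map (tensor_map fs (pure_tensor xs)) * f z"
    unfolding tensor_map_def tensor_mult_pure tensor_lift_pure[OF m(1)] tensor_lift_pure[OF m(2)]
    by (simp add: mult_map_pure linear_0[OF linear_mult_map])
qed

section \<open>Coproducts of products and powers of primitives\<close>

lemma bilinear_compose_linear:
  assumes "bilinear B" "linear f"
  shows "linear (\<lambda>x. B (f x) c)" "linear (\<lambda>x. B c (f x))"
  using assms linear_compose_lambda[of "\<lambda>x. B x c" f] linear_compose_lambda[of "\<lambda>x. B c x" f]
  by (auto simp: bilinear_def)

text \<open>The unshuffle coproduct of a word: all ways of distributing its entries over two
  subwords. A list rather than a set keeps the multiplicities caused by repeated entries.\<close>

fun splits :: "'a list \<Rightarrow> ('a list \<times> 'a list) list" where
  "splits [] = [([], [])]"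
| "splits (p # ps) = map (\<lambda>(l, r). (l, p # r)) (splits ps) @ map (\<lambda>(l, r). (p # l, r)) (splits ps)"

lemma mset_splits: "(l, r) \<in> set (splits ps) \<Longrightarrow> mset l + mset r = mset ps"
  by (induction ps arbitrary: l r) auto

text \<open>Expanding the right-hand product picks \<alpha> p or \<beta> p for each entry, and such
  a pick is a splitting.\<close>

lemma sum_splits_prod:
  fixes \<alpha> \<beta> :: "'a \<Rightarrow> 'b::comm_semiring_1"
  shows "(\<Sum>(l, r)\<leftarrow>splits ps. prod_list (map \<alpha> l) * prod_list (map \<beta> r))
    = prod_list (map (\<lambda>p. \<alpha> p + \<beta> p) ps)"
proof (induction ps)
  case (Cons p ps)
  have "(\<Sum>(l, r)\<leftarrow>splits (p # ps). prod_list (map \<alpha> l) * prod_list (map \<beta> r))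
    = (\<Sum>(l, r)\<leftarrow>splits ps. \<beta> p * (prod_list (map \<alpha> l) * prod_list (map \<beta> r)))
    + (\<Sum>(l, r)\<leftarrow>splits ps. \<alpha> p * (prod_list (map \<alpha> l) * prod_list (map \<beta> r)))"
    by (simp add: case_prod_unfold o_def mult_ac)
  then show ?case
    by (simp add: sum_list_const_mult case_prod_unfold distrib_right add.commute
        flip: Cons.IH)
qed auto

context real_bialgebra
begin

lemma sw_mult:
  assumes B: "bilinear B"
  shows "sw B (x * y) = sw (\<lambda>a b. sw (\<lambda>c d. B (a * c) (b * d)) y) x"
proof -
  let ?L = "tensor_lift (\<lambda>xs. case xs of [y, z] \<Rightarrow> B y z | _ \<Rightarrow> 0)"
  note L = linear_tensor_lift_bilinear[OF B]
  have "?L (tensor_square_mult (pure_tensor [a, b]) (\<Delta> y)) = sw (\<lambda>c d. B (a * c) (b * d)) y" for a b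
    by (subst linear_coproduct_eq_sw[where L = "\<lambda>t. ?L (tensor_square_mult (pure_tensor [a, b]) t)"])
      (auto intro!: linear_compose_lambda[OF L] linear_tensor_square_mult
        simp: tensor_square_mult_pure tensor_lift_bilinear_pure[OF B])
  moreover have "?L (tensor_square_mult (\<Delta> x) (\<Delta> y))
      = sw (\<lambda>a b. ?L (tensor_square_mult (pure_tensor [a, b]) (\<Delta> y))) x"
    by (rule linear_coproduct_eq_sw[where L = "\<lambda>s. ?L (tensor_square_mult s (\<Delta> y))"])
      (intro linear_compose_lambda[OF L] linear_tensor_square_mult)
  ultimately show ?thesis
    by (simp add: sw_def[of B] coproduct_mult)
qed

lemma sw_one: "bilinear B \<Longrightarrow> sw B 1 = B 1 1"
  by (simp add: sw_def coproduct_one tensor_lift_bilinear_pure)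

lemma sw_primitive:
  assumes "p \<in> primitives \<Delta>" "bilinear B"
  shows "sw B p = B 1 p + B p 1"
  using assms(1) unfolding sw_def primitives_def
  by (simp add: linear_add[OF linear_tensor_lift_bilinear[OF assms(2)]]
      tensor_lift_bilinear_pure[OF assms(2)])

lemma sw_primitive_mult:
  assumes p: "p \<in> primitives \<Delta>" and B: "bilinear B"
  shows "sw B (p * y) = sw (\<lambda>c d. B c (p * d) + B (p * c) d) y"
proof -
  have "bilinear (\<lambda>a b. sw (\<lambda>c d. B (a * c) (b * d)) y)"
    by (intro bilinearI linear_sw_param bilinear_compose_linear[OF B] linear_intros)
  moreover have "bilinear (\<lambda>c d. B c (p * d))" "bilinear (\<lambda>c d. B (p * c) d)"
    by (intro bilinearI bilinear_compose_linear[OF B] linear_intros)+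
  ultimately show ?thesis
    using p by (simp add: sw_mult[OF B] sw_primitive sw_add)
qed

text \<open>Each primitive factor goes entirely to the left or to the right leg. The induction
  absorbs the first factor into the bilinear map, which therefore has to be arbitrary.\<close>

lemma sw_prod_list:
  assumes "set ps \<subseteq> primitives \<Delta>" "bilinear B"
  shows "sw B (prod_list ps) = (\<Sum>(l, r)\<leftarrow>splits ps. B (prod_list l) (prod_list r))"
  using assms
proof (induction ps arbitrary: B)
  case (Cons p ps)
  have "bilinear (\<lambda>c d. B c (p * d) + B (p * c) d)"
    by (intro bilinearI linear_intros bilinear_compose_linear[OF Cons.prems(2)])
  from Cons.IH[OF _ this] show ?case
    using Cons.prems by (simp add: sw_primitive_mult sum_list_addf case_prod_unfold o_def)
qed (simp add: sw_one)

text \<open>The two tensors of p with 1 commute even if the algebra does not, which is why the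
  ordinary binomial formula holds.\<close>

lemma sw_primitive_power:
  assumes "p \<in> primitives \<Delta>" "bilinear B"
  shows "sw B (p ^ k) = (\<Sum>i\<le>k. real (k choose i) *\<^sub>R B (p ^ i) (p ^ (k - i)))"
  using assms(2)
proof (induction k arbitrary: B)
  case (Suc k)
  let ?b = "\<lambda>i j. B (p ^ i) (p ^ j)"
  have bil: "bilinear (\<lambda>c d. B c (p * d) + B (p * c) d)"
    by (intro bilinearI linear_intros bilinear_compose_linear[OF Suc.prems])
  \<comment> \<open>Index shift preparing Pascal's rule. The upper limit stays k because
    \<open>k choose Suc k\<close> is 0.\<close>
  have shift: "(\<Sum>i\<le>k. real (k choose i) *\<^sub>R ?b i (Suc k - i))
      = ?b 0 (Suc k) + (\<Sum>i\<le>k. real (k choose Suc i) *\<^sub>R ?b (Suc i) (k - i))"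
    using sum.atMost_Suc_shift[of "\<lambda>i. real (k choose i) *\<^sub>R ?b i (Suc k - i)" k]
    by (simp add: binomial_eq_0)
  have "sw B (p ^ Suc k) = (\<Sum>i\<le>k. real (k choose i) *\<^sub>R (?b i (Suc (k - i)) + ?b (Suc i) (k - i)))"
    using Suc.IH[OF bil] assms(1) Suc.prems by (simp add: sw_primitive_mult)
  also have "\<dots> = (\<Sum>i\<le>k. real (k choose i) *\<^sub>R ?b i (Suc k - i))
      + (\<Sum>i\<le>k. real (k choose i) *\<^sub>R ?b (Suc i) (k - i))"
    by (simp add: scaleR_add_right sum.distrib Suc_diff_le)
  also have "\<dots> = ?b 0 (Suc k) + (\<Sum>i\<le>k. real (Suc k choose Suc i) *\<^sub>R ?b (Suc i) (Suc k - Suc i))"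
    unfolding shift by (simp add: scaleR_add_left sum.distrib)
  also have "\<dots> = (\<Sum>i\<le>Suc k. real (Suc k choose i) *\<^sub>R ?b i (Suc k - i))"
    using sum.atMost_Suc_shift[of "\<lambda>i. real (Suc k choose i) *\<^sub>R ?b i (Suc k - i)" k] by simp
  finally show ?case .
qed (simp add: sw_one)

text \<open>The ratios of geometric eigenvalue sequences add under convolution, by the binomial
  theorem. This is the origin of a ^ k: there are \<open>a\<close> slots, each of ratio 1.\<close>

lemma conv_power:
  assumes p: "p \<in> primitives \<Delta>" and lin: "linear f" "linear g"
    and f: "\<And>k. f (p ^ k) = \<alpha> ^ k *\<^sub>R p ^ k" and g: "\<And>k. g (p ^ k) = \<beta> ^ k *\<^sub>R p ^ k"
  shows "conv f g (p ^ k) = (\<alpha> + \<beta>) ^ k *\<^sub>R p ^ k"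
proof -
  have "conv f g (p ^ k)
      = (\<Sum>i\<le>k. real (k choose i) *\<^sub>R (\<alpha> ^ i *\<^sub>R p ^ i * \<beta> ^ (k - i) *\<^sub>R p ^ (k - i)))"
    unfolding conv_def by (simp add: sw_primitive_power[OF p bilinear_conv[OF lin]] f g)
  also have "\<dots> = (\<Sum>i\<le>k. (real (k choose i) * \<alpha> ^ i * \<beta> ^ (k - i)) *\<^sub>R p ^ k)"
    by (intro sum.cong) (auto simp: mult_ac simp flip: power_add)
  also have "\<dots> = (\<alpha> + \<beta>) ^ k *\<^sub>R p ^ k"
    by (simp add: binomial_ring scaleR_sum_left)
  finally show ?thesis .
qed

lemma subspace_primitives: "subspace (primitives \<Delta>)"
proof (rule subspaceI)
  note l = linear_pure_tensor_pair
  show "0 \<in> primitives \<Delta>"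
    by (simp add: primitives_def linear_0[OF linear_coproduct] linear_0[OF l(1)] linear_0[OF l(2)])
  show "x + y \<in> primitives \<Delta>" if "x \<in> primitives \<Delta>" "y \<in> primitives \<Delta>" for x y
    using that
    by (simp add: primitives_def linear_add[OF linear_coproduct] linear_add[OF l(1)] linear_add[OF l(2)])
  show "c *\<^sub>R x \<in> primitives \<Delta>" if "x \<in> primitives \<Delta>" for c x
    using that
    by (simp add: primitives_def linear_scale[OF linear_coproduct] linear_scale[OF l(1)]
        linear_scale[OF l(2)] scaleR_add_right)
qed

lemma counit_primitive:
  assumes "p \<in> primitives \<Delta>" shows "\<epsilon> p = 0"
proof -
  have "p = sw (\<lambda>y z. \<epsilon> y *\<^sub>R z) p"
    using sw_counit_left[OF linear_ident, of p] by simp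
  also have "\<dots> = p + \<epsilon> p *\<^sub>R 1"
    by (subst sw_primitive[OF assms]) (auto intro!: bilinearI linear_intros linear_counit simp: counit_one)
  finally show ?thesis by simp
qed

text \<open>The mixed terms in the coproduct of p q are symmetric in p and q, so they cancel in the
  commutator.\<close>

lemma primitive_commutator:
  assumes "p \<in> primitives \<Delta>" "q \<in> primitives \<Delta>"
  shows "p * q - q * p \<in> primitives \<Delta>"
proof -
  have bil: "bilinear (\<lambda>c d. pure_tensor [c, d])"
    by (intro bilinearI linear_intros)
  have prod: "\<Delta> (x * y) = pure_tensor [1, x * y] + pure_tensor [y, x] + (pure_tensor [x, y] + pure_tensor [x * y, 1])"
    if "x \<in> primitives \<Delta>" "y \<in> primitives \<Delta>" for x y
  proof -
    have "\<Delta> (x * y) = sw (\<lambda>c d. pure_tensor [c, x * d] + pure_tensor [x * c, d]) y"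
      unfolding coproduct_eq_sw[of "x * y"] by (rule sw_primitive_mult[OF that(1) bil])
    also have "\<dots> = pure_tensor [1, x * y] + pure_tensor [y, x] + (pure_tensor [x, y] + pure_tensor [x * y, 1])"
      by (subst sw_primitive[OF that(2)]) (auto intro!: bilinearI linear_intros)
    finally show ?thesis .
  qed
  show ?thesis
    unfolding primitives_def mem_Collect_eq linear_diff[OF linear_coproduct]
      linear_diff[OF linear_pure_tensor_pair(1)] linear_diff[OF linear_pure_tensor_pair(2)]
    by (simp add: prod assms)
qed

section \<open>Operators with one map in each tensor slot\<close>

definition multi_op :: "(nat \<Rightarrow> 'a \<Rightarrow> 'a) \<Rightarrow> nat \<Rightarrow> 'a \<Rightarrow> 'a" where
  "multi_op F n = mult_map \<circ> tensor_map (map F [0..<n]) \<circ> iterated_coproduct \<Delta> n"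

lemma multi_op_2:
  assumes "\<And>i. linear (F i)"
  shows "multi_op F (Suc (Suc 0)) = conv (F 0) (F 1)"
proof
  fix x
  have "mult_map (tensor_map [F 0, F 1] (\<Delta> x)) = sw (\<lambda>y z. mult_map (pure_tensor [F 0 y, F 1 z])) x"
    unfolding tensor_map_coproduct[OF assms assms]
    by (intro linear_apply_sw linear_mult_map bilinearI linear_intros assms)
  then show "multi_op F (Suc (Suc 0)) x = conv (F 0) (F 1) x"
    by (simp add: multi_op_def conv_def mult_map_pure)
qed

lemma multi_op_Suc:
  assumes "\<And>i. linear (F i)"
  shows "multi_op F (Suc (Suc (Suc n))) = conv (multi_op F (Suc (Suc n))) (F (Suc (Suc n)))"
proof
  fix x
  let ?n = "Suc (Suc n)"
  let ?fs = "map F [0..<?n]"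
  let ?I = "iterated_coproduct \<Delta> ?n"
  have fs: "f \<in> set (?fs @ [F ?n]) \<Longrightarrow> linear f" for f
    using assms by auto
  let ?L = "\<lambda>s. mult_map (tensor_map (?fs @ [F ?n]) s)"
  have L: "linear ?L"
    using fs by (intro linear_compose_lambda[OF linear_mult_map] linear_tensor_map)
  have "?L (tensor_pair ?I (\<lambda>y. pure_tensor [y]) (\<Delta> x))
      = sw (\<lambda>y z. ?L (tensor_pair ?I (\<lambda>y. pure_tensor [y]) (pure_tensor [y, z]))) x"
    by (rule linear_coproduct_eq_sw)
      (intro linear_compose_lambda[OF L] linear_tensor_pair linear_iterated_coproduct linear_pure_tensor_single)
  also have "\<dots> = sw (\<lambda>y z. mult_map (tensor_map ?fs (?I y)) * F ?n z) x"
    using mult_map_tensor_map_snoc[of ?fs "F ?n"] fs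
    by (simp only: tensor_pair_pure[OF linear_iterated_coproduct linear_pure_tensor_single])
  finally show "multi_op F (Suc ?n) x = conv (multi_op F ?n) (F ?n) x"
    by (simp add: multi_op_def conv_def)
qed

text \<open>Induction over the slots for a property that carries a weight additive under
  convolution. The weights are real numbers for powers of a primitive and pairs of them for leading
  symbols.\<close>

lemma multi_op_induct:
  assumes lin: "\<And>i. linear (F i)" and "2 \<le> n"
    and base: "\<And>i. Q (F i) (w i)"
    and step: "\<And>f g v w. linear f \<Longrightarrow> linear g \<Longrightarrow> Q f v \<Longrightarrow> Q g w \<Longrightarrow> Q (conv f g) (v + w)"
  shows "linear (multi_op F n) \<and> Q (multi_op F n) (\<Sum>i<n. w i :: 'w::comm_monoid_add)"
proof -
  define m where "m = n - 2"
  have n: "n = Suc (Suc m)"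
    using \<open>2 \<le> n\<close> by (simp add: m_def)
  have "linear (multi_op F (Suc (Suc m))) \<and> Q (multi_op F (Suc (Suc m))) (\<Sum>i<Suc (Suc m). w i)"
  proof (induction m)
    case 0
    then show ?case
      using step[OF lin[of 0] lin[of 1] base base] by (simp add: multi_op_2[OF lin] linear_conv lin)
  next
    case (Suc m)
    then show ?case
      using step[OF _ lin[of "Suc (Suc m)"] _ base, of _ "\<Sum>i<Suc (Suc m). w i"]
      unfolding multi_op_Suc[OF lin] sum.lessThan_Suc[of _ "Suc (Suc m)"]
      by (intro conjI linear_conv lin) auto
  qed
  then show ?thesis by (simp add: n)
qed

end

lemma mult_in_subspace:
  fixes x y :: "'a::real_algebra"
  assumes "x \<in> span A" "y \<in> span B" "subspace V" and mem: "\<And>a b. a \<in> A \<Longrightarrow> b \<in> B \<Longrightarrow> a * b \<in> V"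
  shows "x * y \<in> V"
proof -
  have "(*) a ` span B \<subseteq> V" if "a \<in> A" for a
    unfolding linear_span_image[OF linear_left_mult[OF linear_ident], symmetric]
    using that mem assms(3) by (intro span_minimal) auto
  then have "(\<lambda>x. x * y) ` A \<subseteq> V" using assms(2) by auto
  then have "(\<lambda>x. x * y) ` span A \<subseteq> V"
    unfolding linear_span_image[OF linear_right_mult[OF linear_ident], symmetric]
    by (intro span_minimal assms(3))
  then show ?thesis using assms(1) by auto
qed

text \<open>A functional that is nonzero on the coefficient vector would turn the relation into a
  real polynomial with a nonzero coefficient that vanishes at every natural number.\<close>

lemma poly_relation_imp_coeff_relation:
  fixes v :: "'i \<Rightarrow> 'v::real_vector"
  assumes "finite I" and zero: "\<And>n::nat. (\<Sum>i\<in>I. poly (q i) (real n) *\<^sub>R v i) = 0"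
  shows "(\<Sum>i\<in>I. coeff (q i) m *\<^sub>R v i) = 0"
proof (rule ccontr)
  let ?w = "\<Sum>i\<in>I. coeff (q i) m *\<^sub>R v i"
  assume "?w \<noteq> 0"
  then have "independent {?w}" by simp
  from linear_independent_extend[OF this, of "\<lambda>_. 1 :: real"]
  obtain \<phi> where \<phi>: "linear \<phi>" "\<phi> ?w = (1::real)" by auto
  define Q where "Q = (\<Sum>i\<in>I. smult (\<phi> (v i)) (q i))"
  have "poly Q (real n) = 0" for n
  proof -
    have "poly Q (real n) = \<phi> (\<Sum>i\<in>I. poly (q i) (real n) *\<^sub>R v i)"
      by (simp add: Q_def poly_sum linear_sum[OF \<phi>(1)] linear_scale[OF \<phi>(1)] mult.commute)
    then show ?thesis by (simp only: zero linear_0[OF \<phi>(1)])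
  qed
  then have "range real \<subseteq> {x. poly Q x = 0}" by auto
  moreover have "infinite (range real)"
    using range_inj_infinite inj_of_nat by blast
  ultimately have "Q = 0"
    using poly_roots_finite finite_subset by blast
  moreover have "coeff Q m = \<phi> ?w"
    by (simp add: Q_def coeff_sum linear_sum[OF \<phi>(1)] linear_scale[OF \<phi>(1)] mult.commute)
  ultimately show False using \<phi>(2) by simp
qed

text \<open>The binomial coefficient x choose k as a polynomial in x. For positive k its coefficient
  of degree 1 is (-1) ^ (k - 1) / k, the coefficient of the logarithm series.\<close>

primrec binomial_poly :: "nat \<Rightarrow> real poly" where
  "binomial_poly 0 = 1"
| "binomial_poly (Suc k) = smult (1 / real (Suc k)) (binomial_poly k * [:- real k, 1:])"

lemma poly_binomial_poly: "poly (binomial_poly k) x = x gchoose k"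
proof (induction k)
  case (Suc k)
  then show ?case
    using gbinomial_mult_1[of x k] by (simp add: field_simps)
qed auto

lemma coeff_0_binomial_poly: "coeff (binomial_poly k) 0 = (if k = 0 then 1 else 0)"
  by (simp add: poly_0_coeff_0[symmetric] poly_binomial_poly gbinomial_0_left)

section \<open>Convolution powers of the identity\<close>

context real_bialgebra
begin

abbreviation (input) conv_unit :: "'a \<Rightarrow> 'a" where
  "conv_unit \<equiv> (\<lambda>x. \<epsilon> x *\<^sub>R 1)"

primrec adams :: "nat \<Rightarrow> 'a \<Rightarrow> 'a" where
  "adams 0 = conv_unit"
| "adams (Suc n) = conv (adams n) (\<lambda>x. x)"

text \<open>The identity minus the convolution unit, that is, the projection onto the kernel of the
  counit. In the connected graded case it kills degree 0, which makes it locally nilpotent for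
  convolution.\<close>

definition reduced :: "'a \<Rightarrow> 'a" where
  "reduced x = x - \<epsilon> x *\<^sub>R 1"

primrec reduced_power :: "nat \<Rightarrow> 'a \<Rightarrow> 'a" where
  "reduced_power 0 = conv_unit"
| "reduced_power (Suc k) = conv (reduced_power k) reduced"

lemma linear_conv_unit: "linear conv_unit"
  by (intro linear_intros linear_counit)

lemma linear_reduced: "linear reduced"
  unfolding reduced_def[abs_def] by (intro linear_intros linear_counit)

lemma linear_adams: "linear (adams n)"
  by (induction n) (auto simp: linear_conv linear_intros linear_conv_unit)

lemma linear_reduced_power: "linear (reduced_power n)"
  by (induction n) (auto simp: linear_conv linear_reduced linear_conv_unit)

lemma conv_unit_left: "linear f \<Longrightarrow> conv conv_unit f = f"
  unfolding conv_def using sw_counit_left by auto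

text \<open>The binomial theorem in the convolution algebra, for the identity written as the unit
  plus \<open>reduced\<close>.\<close>

lemma adams_eq_sum_reduced_power: "adams n x = (\<Sum>k\<le>n. real (n choose k) *\<^sub>R reduced_power k x)"
proof (induction n arbitrary: x)
  case (Suc n)
  let ?r = "\<lambda>k. reduced_power k x"
  have "adams (Suc n) x = conv (adams n) (\<lambda>x. reduced x + \<epsilon> x *\<^sub>R 1) x"
    by (simp add: reduced_def)
  also have "\<dots> = conv (adams n) reduced x + adams n x"
    by (simp add: conv_add_right linear_adams linear_reduced linear_conv_unit conv_counit_right)
  also have "conv (adams n) reduced x = (\<Sum>k\<le>n. real (n choose k) *\<^sub>R ?r (Suc k))"
    by (simp add: conv_def Suc sum_distrib_right sw_sum sw_scaleR)
  also have "adams n x = (\<Sum>k\<le>Suc n. real (n choose k) *\<^sub>R ?r k)"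
    by (simp add: Suc binomial_eq_0)
  also have "\<dots> = ?r 0 + (\<Sum>k\<le>n. real (n choose Suc k) *\<^sub>R ?r (Suc k))"
    by (subst sum.atMost_Suc_shift) simp
  finally show ?case
    by (subst sum.atMost_Suc_shift) (simp add: scaleR_add_left sum.distrib add_ac del: adams.simps)
qed simp

text \<open>Multiplicativity of \<Delta> pairs the four legs as (a, c) and (b, d), while the claim
  pairs them as (a, b) and (c, d). Cocommutativity, through \<open>sw_swap_middle\<close>, repairs
  the mismatch.\<close>

lemma coproduct_conv:
  assumes cc: "cocommutative \<Delta>" and lin: "linear f" "linear g"
    and f: "\<And>x. \<Delta> (f x) = sw (\<lambda>y z. pure_tensor [f y, f z]) x"
    and g: "\<And>x. \<Delta> (g x) = sw (\<lambda>y z. pure_tensor [g y, g z]) x"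
  shows "\<Delta> (conv f g x) = sw (\<lambda>y z. pure_tensor [conv f g y, conv f g z]) x"
proof -
  let ?t = "\<lambda>a b c d. pure_tensor [f a * g c, f b * g d]"
  note li = linear_intros lin
  have "\<Delta> (f u * g v) = sw (\<lambda>a b. sw (\<lambda>c d. ?t a b c d) v) u" for u v
  proof -
    have "\<Delta> (f u * g v) = tensor_square_mult (sw (\<lambda>y z. pure_tensor [f y, f z]) u) (\<Delta> (g v))"
      by (simp add: coproduct_mult f)
    also have "\<dots> = sw (\<lambda>a b. tensor_square_mult (pure_tensor [f a, f b]) (\<Delta> (g v))) u"
      by (rule linear_apply_sw[where f = "\<lambda>s. tensor_square_mult s (\<Delta> (g v))"])
        (intro linear_tensor_square_mult bilinearI li)+
    also have "\<dots> = sw (\<lambda>a b. sw (\<lambda>c d. tensor_square_mult (pure_tensor [f a, f b]) (pure_tensor [g c, g d])) v) u"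
      unfolding g
      by (subst linear_apply_sw[OF linear_tensor_square_mult(2)]) (auto intro!: bilinearI li)
    finally show ?thesis by (simp add: tensor_square_mult_pure)
  qed
  then have "\<Delta> (conv f g x) = sw (\<lambda>u v. sw (\<lambda>a b. sw (\<lambda>c d. ?t a b c d) v) u) x"
    unfolding conv_def by (subst linear_apply_sw[OF linear_coproduct bilinear_conv[OF lin]]) simp
  also have "\<dots> = sw (\<lambda>u v. sw (\<lambda>a b. sw (\<lambda>c d. ?t a c b d) v) u) x"
    by (rule sw_swap_middle[OF cc]) (intro li)+
  also have "(\<lambda>u v. sw (\<lambda>a b. sw (\<lambda>c d. ?t a c b d) v) u) = (\<lambda>u v. pure_tensor [conv f g u, conv f g v])"
  proof (intro ext)
    fix u v
    have "pure_tensor [conv f g u, conv f g v] = sw (\<lambda>a b. pure_tensor [f a * g b, conv f g v]) u"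
      unfolding conv_def[of f g, THEN fun_cong, of u]
      by (rule linear_apply_sw[where f = "\<lambda>s. pure_tensor [s, conv f g v]"]) (intro li bilinearI)+
    also have "\<dots> = sw (\<lambda>a b. sw (\<lambda>c d. pure_tensor [f a * g b, f c * g d]) v) u"
      unfolding conv_def[of f g]
      by (subst linear_apply_sw[where f = "\<lambda>s. pure_tensor [r, s]" for r]) (auto intro!: li bilinearI)
    finally show "sw (\<lambda>a b. sw (\<lambda>c d. ?t a c b d) v) u = pure_tensor [conv f g u, conv f g v]"
      by simp
  qed
  finally show ?thesis .
qed

lemma coproduct_adams:
  assumes "cocommutative \<Delta>"
  shows "\<Delta> (adams n x) = sw (\<lambda>y z. pure_tensor [adams n y, adams n z]) x"
proof (induction n arbitrary: x)
  case 0
  have "sw (\<lambda>y z. \<epsilon> y *\<^sub>R (\<epsilon> z *\<^sub>R pure_tensor [1, 1])) x = \<epsilon> x *\<^sub>R \<Delta> 1"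
    by (subst sw_counit_left) (auto intro!: linear_intros linear_counit simp: coproduct_one)
  then show ?case
    by (simp add: linear_scale[OF linear_coproduct] linear_scale[OF linear_pure_tensor_pair(1)]
        linear_scale[OF linear_pure_tensor_pair(2)] mult.commute)
next
  case (Suc n)
  show ?case
    unfolding adams.simps
    by (rule coproduct_conv[OF assms linear_adams linear_ident Suc coproduct_eq_sw])
qed

end

section \<open>Generation by primitives in the cocommutative case\<close>

context graded_connected_hopf_algebra
begin

lemma subspace_graded: "subspace (H n)"
  using grading by (simp add: is_direct_sum_def)

lemma sw_graded_mem:
  assumes "x \<in> H n" "bilinear B" "subspace V"
    and mem: "\<And>i j y z. i + j = n \<Longrightarrow> y \<in> H i \<Longrightarrow> z \<in> H j \<Longrightarrow> B y z \<in> V"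
  shows "sw B x \<in> V"
proof -
  let ?L = "tensor_lift (\<lambda>xs. case xs of [y, z] \<Rightarrow> B y z | _ \<Rightarrow> 0)"
  let ?X = "{pure_tensor [y, z] | y z i j. i + j = n \<and> y \<in> H i \<and> z \<in> H j}"
  have "?L ` ?X \<subseteq> V"
    using mem by (auto simp: tensor_lift_bilinear_pure[OF assms(2)])
  then have "?L ` span ?X \<subseteq> V"
    unfolding linear_span_image[OF linear_tensor_lift_bilinear[OF assms(2)], symmetric]
    by (rule span_minimal) (rule assms(3))
  then show ?thesis
    using graded_coproduct[OF assms(1)] unfolding sw_def by blast
qed

lemma sw_graded_zero:
  assumes "x \<in> H n" "bilinear B"
    and "\<And>i j y z. i + j = n \<Longrightarrow> y \<in> H i \<Longrightarrow> z \<in> H j \<Longrightarrow> B y z = 0"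
  shows "sw B x = 0"
  using sw_graded_mem[OF assms(1,2), of "{0}"] assms(3) by (simp add: subspace_0 subspace_single_0)

lemma one_degree_0: "1 \<in> H 0"
  by (simp add: connected span_base)

lemma reduced_degree_0: "x \<in> H 0 \<Longrightarrow> reduced x = 0"
  by (auto simp: connected span_singleton reduced_def linear_scale[OF linear_counit] counit_one)

lemma reduced_degree_pos: "x \<in> H n \<Longrightarrow> 0 < n \<Longrightarrow> reduced x = x"
  by (simp add: reduced_def graded_counit)

lemma reduced_graded: "x \<in> H n \<Longrightarrow> reduced x \<in> H n"
  using subspace_0[OF subspace_graded] by (cases n) (auto simp: reduced_degree_0 reduced_degree_pos)

lemma reduced_power_graded: "x \<in> H n \<Longrightarrow> reduced_power k x \<in> H n"
proof (induction k arbitrary: x n)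
  case 0
  then show ?case
    using subspace_0[OF subspace_graded] subspace_scale[OF subspace_graded one_degree_0]
    by (cases n) (auto simp: graded_counit)
next
  case (Suc k)
  then show ?case
    unfolding reduced_power.simps conv_def
    by (intro sw_graded_mem subspace_graded bilinear_conv linear_reduced linear_reduced_power)
      (auto intro: graded_mult reduced_graded)
qed

text \<open>Each of the k factors needs an argument of positive degree, and the degrees add up to n.
  Hence the expansion of \<open>adams\<close> on degree n is a polynomial in the exponent.\<close>

lemma reduced_power_eq_0: "x \<in> H n \<Longrightarrow> n < k \<Longrightarrow> reduced_power k x = 0"
proof (induction k arbitrary: x n)
  case (Suc k)
  show ?case
    unfolding reduced_power.simps conv_def
  proof (rule sw_graded_zero[OF Suc.prems(1)])
    show "reduced_power k y * reduced z = 0" if "i + j = n" "y \<in> H i" "z \<in> H j" for i j y z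
      using that Suc.IH[of y i] Suc.prems(2) by (cases j) (auto simp: reduced_degree_0)
  qed (intro bilinear_conv linear_reduced linear_reduced_power)
qed simp

text \<open>There are at least two factors, since k is positive. A term with a leg of degree 0
  vanishes, so both legs have degree below n.\<close>

lemma reduced_power_decomposable:
  assumes "x \<in> H n" "0 < k"
  shows "reduced_power (Suc k) x \<in> span {y * z | y z i j. i < n \<and> j < n \<and> y \<in> H i \<and> z \<in> H j}"
    (is "_ \<in> span ?X")
  unfolding reduced_power.simps conv_def
proof (rule sw_graded_mem[OF assms(1)])
  show "reduced_power k y * reduced z \<in> span ?X" if "i + j = n" "y \<in> H i" "z \<in> H j" for i j y z
  proof (cases "0 < i \<and> 0 < j")
    case True
    then have "i < n" "j < n" using that by auto
    then have "reduced_power k y * reduced z \<in> ?X"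
      using reduced_power_graded[OF that(2)] reduced_graded[OF that(3)] by blast
    then show ?thesis by (rule span_base)
  next
    case False
    then have "reduced_power k y * reduced z = 0"
      using that assms(2) by (auto simp: reduced_degree_0 reduced_power_eq_0)
    then show ?thesis by (simp add: span_zero)
  qed
qed (intro bilinear_conv linear_reduced linear_reduced_power subspace_span)+

text \<open>The operators \<open>adams n\<close> are coalgebra endomorphisms depending polynomially on \<open>n\<close>; comparing
  the coefficients of \<open>n\<close> in that identity shows that the logarithm of the identity, which is the
  coefficient of \<open>n\<close> in \<open>adams n\<close>, has primitive values.\<close>

lemma log_primitive:
  assumes cc: "cocommutative \<Delta>" and x: "x \<in> H N"
  shows "(\<Sum>k\<le>N. coeff (binomial_poly k) 1 *\<^sub>R reduced_power k x) \<in> primitives \<Delta>"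
proof -
  let ?b = binomial_poly and ?r = reduced_power
  define B where "B = (\<lambda>k l. sw (\<lambda>y z. pure_tensor [?r k y, ?r l z]) x)"
  have bil: "bilinear (\<lambda>y z. pure_tensor [?r k y, ?r l z])" for k l
    by (intro bilinearI linear_intros linear_reduced_power)
  have p0: "pure_tensor [0, z] = 0" "pure_tensor [z, 0] = 0" for z :: 'a
    using linear_0[OF linear_pure_tensor_pair(1)] linear_0[OF linear_pure_tensor_pair(2)] by auto
  have B0: "B k l = 0" if "N < k \<or> N < l" for k l
    unfolding B_def
  proof (rule sw_graded_zero[OF x bil])
    fix i j y z assume ij: "i + j = N" "y \<in> H i" "z \<in> H j"
    show "pure_tensor [?r k y, ?r l z] = 0"
    proof (cases "N < k")
      case True
      then have "?r k y = 0" using ij by (intro reduced_power_eq_0[OF ij(2)]) auto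
      then show ?thesis by (simp add: p0)
    next
      case False
      then have "?r l z = 0" using ij that by (intro reduced_power_eq_0[OF ij(3)]) auto
      then show ?thesis by (simp add: p0)
    qed
  qed
  have choose: "poly (?b k) (real n) = real (n choose k)" for k n
    by (simp add: poly_binomial_poly binomial_gbinomial)
  \<comment> \<open>Replaces the upper limit n by the fixed N, so that both sides of the next
    identity become polynomials in n with vector coefficients.\<close>
  have trunc: "(\<Sum>k\<le>n. real (n choose k) *\<^sub>R w k) = (\<Sum>k\<le>N. real (n choose k) *\<^sub>R w k)"
    if "\<And>k. N < k \<Longrightarrow> w k = 0" for n and w :: "nat \<Rightarrow> 'w::real_vector"
  proof -
    have "(\<Sum>k\<le>n. real (n choose k) *\<^sub>R w k) = (\<Sum>k\<le>max n N. real (n choose k) *\<^sub>R w k)"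
      by (rule sum.mono_neutral_left) (auto simp: binomial_eq_0)
    also have "\<dots> = (\<Sum>k\<le>N. real (n choose k) *\<^sub>R w k)"
      by (rule sum.mono_neutral_right) (auto simp: that)
    finally show ?thesis .
  qed
  have eq: "(\<Sum>k\<le>N. real (n choose k) *\<^sub>R \<Delta> (?r k x))
      = (\<Sum>k\<le>N. \<Sum>l\<le>N. (real (n choose k) * real (n choose l)) *\<^sub>R B k l)" for n
  proof -
    have "(\<Sum>k\<le>N. real (n choose k) *\<^sub>R \<Delta> (?r k x)) = (\<Sum>k\<le>n. real (n choose k) *\<^sub>R \<Delta> (?r k x))"
      by (rule trunc[symmetric]) (simp add: reduced_power_eq_0[OF x] linear_0[OF linear_coproduct])
    also have "\<dots> = \<Delta> (adams n x)"
      by (simp add: adams_eq_sum_reduced_power linear_sum[OF linear_coproduct]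
          linear_scale[OF linear_coproduct])
    also have "\<dots> = sw (\<lambda>y z. pure_tensor [adams n y, adams n z]) x"
      by (rule coproduct_adams[OF cc])
    also have "\<dots> = (\<Sum>k\<le>n. real (n choose k) *\<^sub>R (\<Sum>l\<le>n. real (n choose l) *\<^sub>R B k l))"
    proof -
      have left: "pure_tensor [adams n y, w] = (\<Sum>k\<le>n. real (n choose k) *\<^sub>R pure_tensor [?r k y, w])" for y w
        by (simp add: adams_eq_sum_reduced_power linear_sum[OF linear_pure_tensor_pair(1)]
            linear_scale[OF linear_pure_tensor_pair(1)])
      have right: "pure_tensor [w, adams n y] = (\<Sum>k\<le>n. real (n choose k) *\<^sub>R pure_tensor [w, ?r k y])" for y w
        by (simp add: adams_eq_sum_reduced_power linear_sum[OF linear_pure_tensor_pair(2)]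
            linear_scale[OF linear_pure_tensor_pair(2)])
      show ?thesis
        unfolding left unfolding right B_def sw_sum sw_scaleR ..
    qed
    also have "\<dots> = (\<Sum>k\<le>n. real (n choose k) *\<^sub>R (\<Sum>l\<le>N. real (n choose l) *\<^sub>R B k l))"
      by (intro sum.cong refl arg_cong2[where f = scaleR] trunc) (simp add: B0)
    also have "\<dots> = (\<Sum>k\<le>N. real (n choose k) *\<^sub>R (\<Sum>l\<le>N. real (n choose l) *\<^sub>R B k l))"
      by (rule trunc) (simp add: B0)
    finally show ?thesis by (simp add: scaleR_sum_right)
  qed
  have B_left: "B 0 l = pure_tensor [1, ?r l x]" for l
    unfolding B_def
    by (simp add: linear_scale[OF linear_pure_tensor_pair(1)] sw_counit_left
        linear_pure_tensor_pair_compose(2)[OF linear_reduced_power])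
  have B_right: "B k 0 = pure_tensor [?r k x, 1]" for k
    unfolding B_def
    by (simp add: linear_scale[OF linear_pure_tensor_pair(2)] sw_counit_right
        linear_pure_tensor_pair_compose(1)[OF linear_reduced_power])
  \<comment> \<open>Both sides of \<open>eq\<close> are collected into a single relation, indexed by
    a disjoint union, so that coefficients can be compared.\<close>
  let ?I = "Inl ` {..N} \<union> Inr ` ({..N} \<times> {..N})"
  define q where "q = case_sum ?b (\<lambda>(k, l). ?b k * ?b l)"
  define v where "v = case_sum (\<lambda>k. \<Delta> (?r k x)) (\<lambda>(k, l). - B k l)"
  have split: "(\<Sum>i\<in>?I. f (q i) *\<^sub>R v i) = (\<Sum>k\<le>N. f (?b k) *\<^sub>R \<Delta> (?r k x))
      - (\<Sum>k\<le>N. \<Sum>l\<le>N. f (?b k * ?b l) *\<^sub>R B k l)" for f :: "real poly \<Rightarrow> real"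
    by (subst sum.union_disjoint)
      (auto simp: sum.reindex q_def v_def sum.cartesian_product case_prod_unfold sum_negf)
  have "(\<Sum>i\<in>?I. poly (q i) (real n) *\<^sub>R v i) = 0" for n
    using split[of "\<lambda>p. poly p (real n)"] by (simp add: choose eq)
  then have "(\<Sum>i\<in>?I. coeff (q i) 1 *\<^sub>R v i) = 0"
    by (intro poly_relation_imp_coeff_relation) auto
  then have "(\<Sum>k\<le>N. coeff (?b k) 1 *\<^sub>R \<Delta> (?r k x))
      = (\<Sum>k\<le>N. \<Sum>l\<le>N. coeff (?b k * ?b l) 1 *\<^sub>R B k l)"
    using split[of "\<lambda>p. coeff p 1"] by simp
  \<comment> \<open>Product rule for the coefficient of degree 1. Since
    \<open>binomial_poly k\<close> has constant term 0 unless k = 0, only terms with k = 0 or l = 0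
    survive, and these are the two halves of the primitivity equation.\<close>
  also have "\<dots> = (\<Sum>k\<le>N. \<Sum>l\<le>N. (if k = 0 then coeff (?b l) 1 *\<^sub>R B 0 l else 0)
      + (if l = 0 then coeff (?b k) 1 *\<^sub>R B k 0 else 0))"
    by (intro sum.cong refl) (auto simp: coeff_mult coeff_0_binomial_poly scaleR_add_left)
  also have "\<dots> = (\<Sum>l\<le>N. coeff (?b l) 1 *\<^sub>R B 0 l) + (\<Sum>k\<le>N. coeff (?b k) 1 *\<^sub>R B k 0)"
  proof -
    have if_out: "(\<Sum>l\<le>N. if k = 0 then F l else 0) = (if k = 0 then \<Sum>l\<le>N. F l else 0)"
      for k :: nat and F :: "nat \<Rightarrow> 'a tensor_algebra"
      by simp
    show ?thesis by (simp only: sum.distrib if_out) simp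
  qed
  also have "\<dots> = (\<Sum>l\<le>N. coeff (?b l) 1 *\<^sub>R pure_tensor [1, ?r l x])
      + (\<Sum>k\<le>N. coeff (?b k) 1 *\<^sub>R pure_tensor [?r k x, 1])"
    by (simp only: B_left B_right)
  finally show ?thesis
    by (simp add: primitives_def linear_sum[OF linear_coproduct] linear_scale[OF linear_coproduct]
        linear_sum[OF linear_pure_tensor_pair(1)] linear_sum[OF linear_pure_tensor_pair(2)]
          linear_scale[OF linear_pure_tensor_pair(1)] linear_scale[OF linear_pure_tensor_pair(2)])
qed

text \<open>The length bound is strict, so \<open>gen_filtration (length ps)\<close> consists of the terms of lower order
  than \<open>prod_list ps\<close>, and \<open>gen_filtration 0\<close> is trivial.\<close>

definition gen_filtration :: "nat \<Rightarrow> 'a set" where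
  "gen_filtration k = span (prod_list ` {ps. set ps \<subseteq> primitives \<Delta> \<and> length ps < k})"

lemma subspace_gen_filtration: "subspace (gen_filtration k)"
  by (simp add: gen_filtration_def)

lemma gen_filtration_mono: "k \<le> l \<Longrightarrow> gen_filtration k \<subseteq> gen_filtration l"
  unfolding gen_filtration_def by (intro span_mono image_mono) auto

lemma prod_list_in_gen_filtration:
  "set ps \<subseteq> primitives \<Delta> \<Longrightarrow> length ps < k \<Longrightarrow> prod_list ps \<in> gen_filtration k"
  unfolding gen_filtration_def by (intro span_base) auto

text \<open>The bounds are strict: one factor uses words of length below k, the other of length at
  most l, so concatenations stay below k + l.\<close>

lemma gen_filtration_mult:
  assumes "x \<in> gen_filtration k" "y \<in> gen_filtration (Suc l)"
  shows "x * y \<in> gen_filtration (k + l)" "y * x \<in> gen_filtration (k + l)"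
proof -
  let ?X = "\<lambda>k. prod_list ` {ps. set ps \<subseteq> primitives \<Delta> \<and> length ps < k}"
  have gen: "x * y \<in> gen_filtration m"
    if xy: "x \<in> span (?X k)" "y \<in> span (?X l)"
      and m: "\<And>i j. i < k \<Longrightarrow> j < l \<Longrightarrow> i + j < m" for x y k l m
  proof (rule mult_in_subspace[OF xy subspace_gen_filtration])
    fix u v assume "u \<in> ?X k" "v \<in> ?X l"
    then obtain ps qs where "u = prod_list ps" "set ps \<subseteq> primitives \<Delta>" "length ps < k"
      "v = prod_list qs" "set qs \<subseteq> primitives \<Delta>" "length qs < l" by auto
    then show "u * v \<in> gen_filtration m"
      using prod_list_in_gen_filtration[of "ps @ qs" m] m by simp
  qed
  show "x * y \<in> gen_filtration (k + l)" "y * x \<in> gen_filtration (k + l)"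
    using assms unfolding gen_filtration_def[of k] gen_filtration_def[of "Suc l"]
    by (auto intro!: gen)
qed

lemma subspace_Union_gen_filtration: "subspace (\<Union>k. gen_filtration k)"
proof (rule subspaceI)
  fix x y assume "x \<in> (\<Union>k. gen_filtration k)" "y \<in> (\<Union>k. gen_filtration k)"
  then obtain k l where "x \<in> gen_filtration k" "y \<in> gen_filtration l" by auto
  then have "x \<in> gen_filtration (max k l)" "y \<in> gen_filtration (max k l)"
    using gen_filtration_mono[of k "max k l"] gen_filtration_mono[of l "max k l"] by auto
  then show "x + y \<in> (\<Union>k. gen_filtration k)"
    using subspace_add[OF subspace_gen_filtration] by blast
qed (use subspace_0[OF subspace_gen_filtration] subspace_scale[OF subspace_gen_filtration] in blast)+

lemma generated_by_primitives:
  assumes cc: "cocommutative \<Delta>"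
  shows "\<exists>k. x \<in> gen_filtration k"
proof -
  let ?U = "\<Union>k. gen_filtration k"
  note U = subspace_Union_gen_filtration
  have hom: "x \<in> H n \<Longrightarrow> x \<in> ?U" for x n
  proof (induction n arbitrary: x rule: less_induct)
    case (less n)
    have one: "1 \<in> ?U" using prod_list_in_gen_filtration[of "[]" 1] by auto
    show ?case
    proof (cases n)
      case 0
      then show ?thesis
        using less.prems one subspace_scale[OF U] by (auto simp: connected span_singleton)
    next
      case (Suc m)
      have "y * z \<in> ?U" if yz: "i < n" "j < n" "y \<in> H i" "z \<in> H j" for i j y z
      proof -
        obtain k l where "y \<in> gen_filtration k" "z \<in> gen_filtration l"
          using less.IH[OF yz(1,3)] less.IH[OF yz(2,4)] by auto
        then have "z \<in> gen_filtration (Suc l)"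
          using gen_filtration_mono[of l "Suc l"] by auto
        then show ?thesis
          using gen_filtration_mult(1)[OF \<open>y \<in> gen_filtration k\<close>] by blast
      qed
      then have dec: "span {y * z | y z i j. i < n \<and> j < n \<and> y \<in> H i \<and> z \<in> H j} \<subseteq> ?U"
        by (intro span_minimal U) blast
      \<comment> \<open>The logarithm series from index 2 to n = Suc m, whose terms are
        decomposable. Index 0 contributes nothing because \<open>binomial_poly 0\<close> is
        constant, and index 1 contributes x.\<close>
      define r where "r = (\<Sum>k<m. coeff (binomial_poly (Suc (Suc k))) 1 *\<^sub>R reduced_power (Suc (Suc k)) x)"
      let ?e = "\<Sum>k\<le>n. coeff (binomial_poly k) 1 *\<^sub>R reduced_power k x"
      have "r \<in> ?U"
        unfolding r_def
        using dec reduced_power_decomposable[OF less.prems]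
        by (intro subspace_sum[OF U] subspace_scale[OF U]) blast
      moreover have "?e \<in> ?U"
        using prod_list_in_gen_filtration[of "[?e]" 2] log_primitive[OF cc less.prems] by auto
      moreover have "?e = x + r"
      proof -
        have "reduced_power 1 x = x"
          using conv_unit_left[OF linear_reduced] reduced_degree_pos[OF less.prems] Suc by simp
        moreover have "coeff (binomial_poly 1) 1 = 1" by simp
        ultimately show ?thesis
          unfolding r_def Suc
          by (simp only: sum.atMost_Suc_shift[of _ m] lessThan_Suc_atMost[symmetric] sum.lessThan_Suc_shift)
            (simp del: binomial_poly.simps(2) reduced_power.simps)
      qed
      ultimately show ?thesis
        using subspace_diff[OF U, of ?e r] by simp
    qed
  qed
  obtain c where c: "\<And>n. c n \<in> H n" "x = (\<Sum>n | c n \<noteq> 0. c n)"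
    using grading unfolding is_direct_sum_def by metis
  have "x \<in> ?U"
    by (subst c(2)) (rule subspace_sum[OF U hom[OF c(1)]])
  then show ?thesis by blast
qed

end

section \<open>Polarisation\<close>

lemma prod_list_sum_distrib_PiE:
  fixes h :: "nat \<Rightarrow> nat \<Rightarrow> 'b::semiring_1"
  assumes "finite S"
  shows "prod_list (map (\<lambda>i. \<Sum>j\<in>S. h i j) [0..<k])
    = (\<Sum>f\<in>PiE {..<k} (\<lambda>_. S). prod_list (map (\<lambda>i. h i (f i)) [0..<k]))"
proof (induction k)
  case (Suc k)
  let ?M = "\<lambda>k f. prod_list (map (\<lambda>i. h i (f i)) [0..<k])"
  let ?P = "PiE {..<k} (\<lambda>_. S)"
  have M: "?M k (g(k := y)) = ?M k g" for g y
    by (intro arg_cong[where f = prod_list] map_cong) auto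
  have "(\<Sum>f\<in>PiE {..<Suc k} (\<lambda>_. S). ?M (Suc k) f)
      = (\<Sum>f\<in>(\<lambda>(y, g). g(k := y)) ` (S \<times> ?P). ?M (Suc k) f)"
    by (simp add: lessThan_Suc PiE_insert_eq)
  also have "\<dots> = (\<Sum>(y, g)\<in>S \<times> ?P. ?M (Suc k) (g(k := y)))"
    by (subst sum.reindex[OF inj_combinator]) (auto simp: case_prod_unfold)
  also have "\<dots> = (\<Sum>y\<in>S. \<Sum>g\<in>?P. ?M k g * h k y)"
    unfolding sum.cartesian_product[symmetric] using M by simp
  also have "\<dots> = (\<Sum>g\<in>?P. ?M k g) * (\<Sum>y\<in>S. h k y)"
    by (simp add: sum_distrib_left sum_distrib_right)
  finally show ?case by (simp add: Suc)
qed simp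

text \<open>An alternating sum over an interval of subsets vanishes unless the interval is a single
  point. The extra k in the exponent makes the sign at the full set +1.\<close>

lemma sum_sign_supersets:
  assumes "I \<subseteq> {..<k}"
  shows "(\<Sum>S | I \<subseteq> S \<and> S \<subseteq> {..<k}. (- 1) ^ (k + card S)) = (if I = {..<k} then 1 else 0 :: real)"
proof (cases "I = {..<k}")
  case True
  then have "{S. I \<subseteq> S \<and> S \<subseteq> {..<k}} = {{..<k}}" by auto
  then show ?thesis using True by simp
next
  case False
  then have "I \<subset> {..<k}" using assms by auto
  have "(\<Sum>S | I \<subseteq> S \<and> S \<subseteq> {..<k}. (- 1) ^ card S) = (0::real)"
  proof (rule sum_alternating_cancels)
    show "finite {S. I \<subseteq> S \<and> S \<subseteq> {..<k}}"
      by (rule finite_subset[of _ "Pow {..<k}"]) auto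
    show "card {x \<in> {S. I \<subseteq> S \<and> S \<subseteq> {..<k}}. even (card x)}
        = card {x \<in> {S. I \<subseteq> S \<and> S \<subseteq> {..<k}}. odd (card x)}"
      using card_subsupersets_even_odd[OF _ \<open>I \<subset> {..<k}\<close>] by (simp add: conj_ac)
  qed
  then show ?thesis
    using False by (simp add: power_add flip: sum_distrib_left)
qed

text \<open>Expanding the products gives one term per choice function, which occurs for each S
  containing its image. The signed count of these S kills every function that is not onto.\<close>

lemma polarisation:
  fixes h :: "nat \<Rightarrow> nat \<Rightarrow> 'b::real_algebra_1"
  shows "(\<Sum>\<sigma> | \<sigma> permutes {..<k}. prod_list (map (\<lambda>i. h i (\<sigma> i)) [0..<k]))
    = (\<Sum>S\<in>Pow {..<k}. (- 1) ^ (k + card S) *\<^sub>R prod_list (map (\<lambda>i. \<Sum>j\<in>S. h i j) [0..<k]))"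
proof -
  let ?A = "{..<k}"
  let ?M = "\<lambda>f. prod_list (map (\<lambda>i. h i (f i)) [0..<k])"
  let ?F = "PiE ?A (\<lambda>_. ?A)"
  have finF: "finite ?F" by (intro finite_PiE) auto
  have "(\<Sum>S\<in>Pow ?A. (- 1) ^ (k + card S) *\<^sub>R prod_list (map (\<lambda>i. \<Sum>j\<in>S. h i j) [0..<k]))
      = (\<Sum>S\<in>Pow ?A. \<Sum>f\<in>?F. if f ` ?A \<subseteq> S then (- 1) ^ (k + card S) *\<^sub>R ?M f else 0)"
  proof (intro sum.cong refl)
    fix S assume S: "S \<in> Pow ?A"
    then have "PiE ?A (\<lambda>_. S) = {f \<in> ?F. f ` ?A \<subseteq> S}"
      by (auto simp: PiE_def Pi_iff)
    then show "(- 1) ^ (k + card S) *\<^sub>R prod_list (map (\<lambda>i. \<Sum>j\<in>S. h i j) [0..<k])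
        = (\<Sum>f\<in>?F. if f ` ?A \<subseteq> S then (- 1) ^ (k + card S) *\<^sub>R ?M f else 0)"
      using S finite_subset[of S ?A]
      by (auto simp: prod_list_sum_distrib_PiE scaleR_sum_right sum.inter_filter[OF finF]
          intro!: sum.cong)
  qed
  also have "\<dots> = (\<Sum>f\<in>?F. \<Sum>S\<in>Pow ?A. if f ` ?A \<subseteq> S then (- 1) ^ (k + card S) *\<^sub>R ?M f else 0)"
    by (rule sum.swap)
  also have "\<dots> = (\<Sum>f\<in>?F. if f ` ?A = ?A then ?M f else 0)"
  proof (intro sum.cong refl)
    fix f assume "f \<in> ?F"
    then have f: "f ` ?A \<subseteq> ?A" by auto
    have "(\<Sum>S\<in>Pow ?A. if f ` ?A \<subseteq> S then (- 1) ^ (k + card S) *\<^sub>R ?M f else 0)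
        = (\<Sum>S | f ` ?A \<subseteq> S \<and> S \<subseteq> ?A. (- 1) ^ (k + card S) *\<^sub>R ?M f)"
      by (subst sum.inter_filter[symmetric]) (auto intro!: sum.cong)
    also have "\<dots> = (if f ` ?A = ?A then ?M f else 0)"
      unfolding scaleR_sum_left[symmetric] sum_sign_supersets[OF f] by simp
    finally show "(\<Sum>S\<in>Pow ?A. if f ` ?A \<subseteq> S then (- 1) ^ (k + card S) *\<^sub>R ?M f else 0)
        = (if f ` ?A = ?A then ?M f else 0)" .
  qed
  also have "\<dots> = (\<Sum>f\<in>{f \<in> ?F. f ` ?A = ?A}. ?M f)"
    by (rule sum.inter_filter[OF finF, symmetric])
  \<comment> \<open>A surjection of a finite set onto itself is a bijection. The two descriptions
    differ only off \<open>?A\<close>, where \<open>PiE\<close> prescribes \<open>undefined\<close>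
    and \<open>permutes\<close> the identity.\<close>
  also have "\<dots> = (\<Sum>\<sigma> | \<sigma> permutes ?A. ?M \<sigma>)"
  proof (rule sum.reindex_bij_witness[where i = "\<lambda>\<sigma>. restrict \<sigma> ?A"
        and j = "\<lambda>f x. if x \<in> ?A then f x else x"])
    fix f assume f: "f \<in> {f \<in> ?F. f ` ?A = ?A}"
    show "restrict (\<lambda>x. if x \<in> ?A then f x else x) ?A = f"
      using f by (auto simp: fun_eq_iff PiE_iff extensional_def)
    have "bij_betw f ?A ?A"
      using f by (simp add: bij_betw_def eq_card_imp_inj_on)
    then have "bij_betw (\<lambda>x. if x \<in> ?A then f x else x) ?A ?A"
      by (subst bij_betw_cong[where g = f]) auto
    then show "(\<lambda>x. if x \<in> ?A then f x else x) \<in> {\<sigma>. \<sigma> permutes ?A}"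
      by (auto intro!: bij_imp_permutes split: if_splits)
    show "?M (\<lambda>x. if x \<in> ?A then f x else x) = ?M f"
      by (intro arg_cong[where f = prod_list] map_cong) auto
  next
    fix \<sigma> assume \<sigma>: "\<sigma> \<in> {\<sigma>. \<sigma> permutes ?A}"
    then show "(\<lambda>x. if x \<in> ?A then restrict \<sigma> ?A x else x) = \<sigma>"
      by (auto simp: fun_eq_iff permutes_not_in)
    show "restrict \<sigma> ?A \<in> {f \<in> ?F. f ` ?A = ?A}"
      using \<sigma> permutes_image[of \<sigma> ?A] by auto
  qed
  finally show ?thesis by simp
qed

lemma sym_product_eq_sum_powers:
  "sym_product ps = (\<Sum>S\<in>Pow {..<length ps}.
     (- 1) ^ (length ps + card S) *\<^sub>R (\<Sum>j\<in>S. ps ! j) ^ length ps)"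
  unfolding sym_product_def
  by (subst polarisation[where h = "\<lambda>i j. ps ! j"]) (simp add: map_replicate_const)

lemma sym_product_eq_permute_list:
  "sym_product ps = (\<Sum>\<sigma> | \<sigma> permutes {..<length ps}. prod_list (permute_list \<sigma> ps))"
  by (simp add: sym_product_def permute_list_def)

lemma sym_product_cong_mset:
  assumes "mset ps = mset qs"
  shows "sym_product ps = sym_product qs"
proof -
  have len: "length ps = length qs" using assms by (rule mset_eq_length)
  obtain \<pi> where \<pi>: "\<pi> permutes {..<length qs}" "permute_list \<pi> qs = ps"
    using mset_eq_permutation[OF assms] by blast
  have "sym_product ps = (\<Sum>\<sigma> | \<sigma> permutes {..<length qs}. prod_list (permute_list (\<pi> \<circ> \<sigma>) qs))"
    unfolding sym_product_eq_permute_list len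
    by (intro sum.cong refl) (auto simp: permute_list_compose \<pi>)
  also have "\<dots> = (\<Sum>\<sigma> | \<sigma> permutes {..<length qs}. prod_list (permute_list \<sigma> qs))"
    by (rule setum_permutations_compose_left[OF \<pi>(1), symmetric])
  finally show ?thesis by (simp add: sym_product_eq_permute_list)
qed

text \<open>Insertion sort, for an order given as a relation on a set.\<close>

lemma ex_sorted_permutation:
  assumes "linear_order_on P r" "set ps \<subseteq> P"
  shows "\<exists>qs. mset qs = mset ps \<and> sorted_wrt (\<lambda>x y. (x, y) \<in> r) qs"
  using assms(2)
proof (induction ps)
  case (Cons x ps)
  then obtain qs where qs: "mset qs = mset ps" "sorted_wrt (\<lambda>x y. (x, y) \<in> r) qs"
    by auto
  have "set qs \<subseteq> P" using Cons.prems qs(1) mset_eq_setD[OF qs(1)] by auto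
  let ?qs = "filter (\<lambda>y. (y, x) \<in> r) qs @ x # filter (\<lambda>y. (y, x) \<notin> r) qs"
  have tot: "(x, y) \<in> r" if "y \<in> P" "(y, x) \<notin> r" for y
    using assms(1) that Cons.prems
    by (cases "y = x") (auto simp: linear_order_on_def partial_order_on_def preorder_on_def total_on_def refl_on_def)
  have tr: "trans r"
    using assms(1) by (auto simp: linear_order_on_def partial_order_on_def preorder_on_def)
  have "sorted_wrt (\<lambda>x y. (x, y) \<in> r) ?qs"
    using qs(2) tot \<open>set qs \<subseteq> P\<close> transD[OF tr]
    by (auto simp: sorted_wrt_append sorted_wrt_filter)
  moreover have "mset ?qs = mset (x # ps)"
    using qs(1) by simp
  ultimately show ?case by blast
qed auto

lemma sorted_wrt_mset_unique:
  assumes "antisym r" "sorted_wrt (\<lambda>x y. (x, y) \<in> r) ps" "sorted_wrt (\<lambda>x y. (x, y) \<in> r) qs"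
    "mset ps = mset qs"
  shows "ps = qs"
  using assms(2-)
proof (induction ps arbitrary: qs)
  case (Cons p ps)
  then obtain q qs' where qs: "qs = q # qs'" by (cases qs) auto
  have "p = q"
  proof (rule ccontr)
    assume "p \<noteq> q"
    then have "p \<in> set qs'" "q \<in> set ps"
      using mset_eq_setD[OF Cons.prems(3)] qs by auto
    then show False
      using Cons.prems(1,2) qs \<open>p \<noteq> q\<close> antisymD[OF assms(1)] by auto
  qed
  then show ?case using Cons qs by auto
qed simp

section \<open>Spectral decomposition\<close>

lemma linear_shift_power: "linear T \<Longrightarrow> linear ((\<lambda>y. T y - c *\<^sub>R y) ^^ n)"
proof (induction n)
  case (Suc n)
  then show ?case
    using linear_compose[OF Suc.IH, of "\<lambda>y. T y - c *\<^sub>R y"]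
    by (simp add: linear_intros o_def)
qed (simp add: linear_id)

lemma shift_power_eigenvector:
  assumes "linear T" "w \<in> eigenspace T l"
  shows "((\<lambda>y. T y - c *\<^sub>R y) ^^ n) w = (l - c) ^ n *\<^sub>R w"
  using assms(2)
  by (induction n) (auto simp: eigenspace_def linear_scale[OF assms(1)] algebra_simps)

lemma subspace_eigenspace: "linear T \<Longrightarrow> subspace (eigenspace T c)"
  by (auto simp: subspace_def eigenspace_def linear_0 linear_add linear_scale scaleR_add_right)

lemma subspace_generalised_eigenspace:
  assumes T: "linear T"
  shows "subspace (generalised_eigenspace T c)"
proof (rule subspaceI)
  let ?S = "\<lambda>n. (\<lambda>y. T y - c *\<^sub>R y) ^^ n"
  note lin = linear_shift_power[OF T, where c = c]
  show "0 \<in> generalised_eigenspace T c"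
    by (auto simp: generalised_eigenspace_def linear_0[OF lin])
  show "x + y \<in> generalised_eigenspace T c"
    if xy: "x \<in> generalised_eigenspace T c" "y \<in> generalised_eigenspace T c" for x y
  proof -
    obtain m n where "?S m x = 0" "?S n y = 0"
      using xy by (auto simp: generalised_eigenspace_def)
    then have "?S (n + m) x = 0" "?S (m + n) y = 0"
      by (simp_all add: funpow_add linear_0[OF lin])
    then have "?S (m + n) (x + y) = 0" by (simp add: linear_add[OF lin] add.commute)
    then show ?thesis by (auto simp: generalised_eigenspace_def)
  qed
  show "a *\<^sub>R x \<in> generalised_eigenspace T c" if "x \<in> generalised_eigenspace T c" for a x
    using that by (auto simp: generalised_eigenspace_def linear_scale[OF lin])
qed

lemma generalised_eigenspace_0: "generalised_eigenspace T 0 = {x. \<exists>n. (T ^^ n) x = 0}"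
  by (simp add: generalised_eigenspace_def)

lemma generalised_eigenspace_0_I:
  assumes "T x \<in> generalised_eigenspace T 0" shows "x \<in> generalised_eigenspace T 0"
proof -
  from assms obtain n where "(T ^^ n) (T x) = 0" by (auto simp: generalised_eigenspace_0)
  then have "(T ^^ Suc n) x = 0" by (simp add: funpow_swap1)
  then show ?thesis unfolding generalised_eigenspace_0 by blast
qed

text \<open>T commutes with its shift, so by induction on n the vector T g is 0. Then the shifted
  power acts on g as the nonzero scalar (- c) ^ m.\<close>

lemma generalised_eigenspace_0_disjoint:
  assumes T: "linear T" and "c \<noteq> 0"
    and "((\<lambda>y. T y - c *\<^sub>R y) ^^ m) g = 0" "(T ^^ n) g = 0"
  shows "g = 0"
  using assms(3,4)
proof (induction n arbitrary: g)
  case (Suc n)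
  let ?S = "(\<lambda>y. T y - c *\<^sub>R y) ^^ m"
  have comm: "?S (T y) = T (?S y)" for y
    by (induction m) (auto simp: linear_diff[OF T] linear_scale[OF T])
  have "T g = 0"
  proof (rule Suc.IH)
    show "?S (T g) = 0" unfolding comm Suc.prems(1) by (rule linear_0[OF T])
    show "(T ^^ n) (T g) = 0" using Suc.prems(2) unfolding funpow_Suc_right by simp
  qed
  then have "g \<in> eigenspace T 0" by (simp add: eigenspace_def)
  from shift_power_eigenvector[OF T this, where c = c and n = m] show ?case
    using Suc.prems(1) \<open>c \<noteq> 0\<close> by simp
qed simp

text \<open>Applying T and subtracting l n times the sum removes the last term and rescales the
  others by nonzero factors.\<close>

lemma eigenvectors_sum_eq_0:
  fixes l :: "nat \<Rightarrow> real"
  assumes T: "linear T" and l: "inj l"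
    and "\<And>k. w k \<in> eigenspace T (l k)" "(\<Sum>k<n. w k) = 0" "k < n"
  shows "w k = 0"
  using assms(3-)
proof (induction n arbitrary: w k)
  case (Suc n)
  have w: "T (w k) = l k *\<^sub>R w k" for k
    using Suc.prems(1) by (auto simp: eigenspace_def)
  have "(\<Sum>k<n. (l k - l n) *\<^sub>R w k) = (\<Sum>k<Suc n. (l k - l n) *\<^sub>R w k)" by simp
  also have "\<dots> = T (\<Sum>k<Suc n. w k) - l n *\<^sub>R (\<Sum>k<Suc n. w k)"
    by (simp only: linear_sum[OF T] w scaleR_sum_right sum_subtractf scaleR_diff_left)
  also have "\<dots> = 0" by (simp only: Suc.prems(2) linear_0[OF T]) simp
  finally have "(l j - l n) *\<^sub>R w j = 0" if "j < n" for j
    using that by (intro Suc.IH[of "\<lambda>k. (l k - l n) *\<^sub>R w k"]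
        subspace_scale[OF subspace_eigenspace[OF T] Suc.prems(1)])
  then have z: "w j = 0" if "j < n" for j
    using injD[OF l, of j n] that by fastforce
  then show ?case
    using Suc.prems(2,3) by (cases "k = n") auto
qed simp

lemma span_Union_decompose:
  assumes "w \<in> span (\<Union>k::nat. B k)"
  shows "\<exists>n v. (\<forall>k. v k \<in> span (B k)) \<and> w = (\<Sum>k<n. v k)"
proof -
  obtain t r where t: "finite t" "t \<subseteq> (\<Union>k. B k)" "w = (\<Sum>b\<in>t. r b *\<^sub>R b)"
    using assms unfolding span_explicit by blast
  then obtain idx where idx: "\<And>b. b \<in> t \<Longrightarrow> b \<in> B (idx b)"
    by (metis UN_E subsetD)
  define v where "v = (\<lambda>k. \<Sum>b | b \<in> t \<and> idx b = k. r b *\<^sub>R b)"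
  obtain n where "idx ` t \<subseteq> {..<n}"
    using finite_nat_iff_bounded[of "idx ` t"] t(1) by auto
  then have "w = (\<Sum>k<n. v k)"
    unfolding t(3) v_def by (subst sum.group[OF t(1)]) auto
  moreover have "v k \<in> span (B k)" for k
    unfolding v_def by (intro span_sum span_scale span_base) (auto dest: idx)
  ultimately show ?thesis by blast
qed

text \<open>The linear algebra of a single operator, in any dimension. It is applied with l k = a ^
  k and with \<open>B k\<close> the symmetrised products of length k.\<close>

locale eigen_family =
  fixes T :: "'a::real_vector \<Rightarrow> 'a" and l :: "nat \<Rightarrow> real" and B :: "nat \<Rightarrow> 'a set"
  assumes T: "linear T" and inj_l: "inj l" and l_nonzero: "l k \<noteq> 0"
    and eigen: "B k \<subseteq> eigenspace T (l k)"
begin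

lemma span_eigen: "span (B k) \<subseteq> eigenspace T (l k)"
  by (intro span_minimal eigen subspace_eigenspace T)

text \<open>The spectral statements all follow once this subspace is the whole space, which is the
  target of the filtration argument.\<close>

definition decomposable_part :: "'a set" where
  "decomposable_part = {w + g | w g. w \<in> span (\<Union>k. B k) \<and> g \<in> generalised_eigenspace T 0}"

lemma subspace_decomposable_part: "subspace decomposable_part"
  unfolding decomposable_part_def
  by (rule subspace_sums) (auto intro: subspace_generalised_eigenspace T)

text \<open>T is invertible on the span of the eigenvectors because every l k is nonzero.
  Subtracting a preimage of the eigenvector part leaves a vector that T sends into the generalised
  0-eigenspace.\<close>

lemma decomposable_part_preimage:
  assumes "T x \<in> decomposable_part" shows "x \<in> decomposable_part"
proof -
  from assms obtain w g where w: "w \<in> span (\<Union>k. B k)" and g: "g \<in> generalised_eigenspace T 0"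
    and eq: "T x = w + g" by (auto simp: decomposable_part_def)
  obtain n v where v: "\<And>k. v k \<in> span (B k)" "w = (\<Sum>k<n. v k)"
    using span_Union_decompose[OF w] by blast
  define w' where "w' = (\<Sum>k<n. (1 / l k) *\<^sub>R v k)"
  have "T (v k) = l k *\<^sub>R v k" for k
    using v(1)[of k] span_eigen[of k] by (auto simp: eigenspace_def)
  then have "T w' = w"
    by (simp add: w'_def v(2) linear_sum[OF T] linear_scale[OF T] l_nonzero)
  then have "T (x - w') = g"
    by (simp add: linear_diff[OF T] eq)
  then have "x - w' \<in> generalised_eigenspace T 0"
    using g by (auto intro: generalised_eigenspace_0_I[of T "x - w'"])
  moreover have "v k \<in> span (\<Union>k. B k)" for k
    using v(1)[of k] span_mono[of "B k" "\<Union>k. B k"] by auto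
  then have "w' \<in> span (\<Union>k. B k)"
    unfolding w'_def by (intro span_sum span_scale)
  moreover have "x = w' + (x - w')" by simp
  ultimately show ?thesis
    unfolding decomposable_part_def by blast
qed

text \<open>A power of T that kills w multiplies each eigencomponent by a nonzero scalar, so every
  component is 0.\<close>

lemma span_inter_generalised_0:
  assumes "w \<in> span (\<Union>k. B k)" "w \<in> generalised_eigenspace T 0"
  shows "w = 0"
proof -
  obtain n v where v: "\<And>k. v k \<in> span (B k)" "w = (\<Sum>k<n. v k)"
    using span_Union_decompose[OF assms(1)] by blast
  have ve: "v k \<in> eigenspace T (l k)" for k using v(1) span_eigen by blast
  obtain m where m: "(T ^^ m) w = 0" using assms(2) by (auto simp: generalised_eigenspace_0)
  have lin: "linear (T ^^ m)"
    using linear_shift_power[OF T, where c = 0 and n = m] by simp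
  have "(\<Sum>k<n. l k ^ m *\<^sub>R v k) = (\<Sum>k<n. (T ^^ m) (v k))"
    using shift_power_eigenvector[OF T ve, where c = 0 and n = m] by simp
  also have "\<dots> = 0"
    using m unfolding v(2) linear_sum[OF lin] .
  finally have "(\<Sum>k<n. l k ^ m *\<^sub>R v k) = 0" .
  then have "l k ^ m *\<^sub>R v k = 0" if "k < n" for k
    using that by (intro eigenvectors_sum_eq_0[OF T inj_l, of "\<lambda>k. l k ^ m *\<^sub>R v k"]
        subspace_scale[OF subspace_eigenspace[OF T] ve])
  then have "v k = 0" if "k < n" for k using that l_nonzero by simp
  then show ?thesis by (simp add: v(2))
qed

lemma complementary_span:
  assumes "decomposable_part = UNIV"
  shows "complementary (span (\<Union>k. B k)) (generalised_eigenspace T 0)"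
  unfolding complementary_def
proof (intro conjI allI)
  show "span (\<Union>k. B k) \<inter> generalised_eigenspace T 0 = {0}"
    using span_inter_generalised_0 span_zero
      subspace_0[OF subspace_generalised_eigenspace[OF T, of 0]] by blast
  show "\<exists>v\<in>span (\<Union>k. B k). \<exists>w\<in>generalised_eigenspace T 0. x = v + w" for x
    using assms unfolding decomposable_part_def by blast
qed (auto intro: subspace_generalised_eigenspace T)

text \<open>A power of the shifted operator annihilates x = w + g, hence w and g separately because
  the sum is direct. This forces g = 0 and leaves only the component of w in the span of
  \<open>B k\<close>.\<close>

lemma generalised_eigenspace_subset:
  assumes "decomposable_part = UNIV"
  shows "generalised_eigenspace T (l k) \<subseteq> span (B k)"
proof
  fix x assume x: "x \<in> generalised_eigenspace T (l k)"
  let ?S = "\<lambda>m. (\<lambda>y. T y - l k *\<^sub>R y) ^^ m"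
  note lin = linear_shift_power[OF T, where c = "l k"]
  obtain m where "?S m x = 0" using x by (auto simp: generalised_eigenspace_def)
  then have m: "?S (Suc m) x = 0" by (simp add: linear_0[OF T])
  obtain w g where w: "w \<in> span (\<Union>k. B k)" and g: "g \<in> generalised_eigenspace T 0"
    and eq: "x = w + g" using assms unfolding decomposable_part_def by blast
  obtain n v where v: "\<And>k. v k \<in> span (B k)" "w = (\<Sum>k<n. v k)"
    using span_Union_decompose[OF w] by blast
  have ve: "v k \<in> eigenspace T (l k)" for k using v(1) span_eigen by blast
  have Sw: "?S (Suc m) w = (\<Sum>i<n. (l i - l k) ^ Suc m *\<^sub>R v i)"
    unfolding v(2) linear_sum[OF lin] shift_power_eigenvector[OF T ve] ..
  obtain j where j: "(T ^^ j) g = 0" using g by (auto simp: generalised_eigenspace_0)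
  have comm: "(T ^^ j) (?S i y) = ?S i ((T ^^ j) y)" for i y
  proof (induction j arbitrary: y)
    case (Suc j)
    have "T (?S i y) = ?S i (T y)" for y
      by (induction i) (auto simp: linear_diff[OF T] linear_scale[OF T])
    then show ?case by (simp add: Suc)
  qed simp
  have "?S (Suc m) g \<in> generalised_eigenspace T 0"
    unfolding generalised_eigenspace_0 mem_Collect_eq
    by (rule exI[of _ j]) (simp only: comm j linear_0[OF lin])
  moreover have "?S (Suc m) w \<in> span (\<Union>k. B k)"
    unfolding Sw using v(1) span_mono[of "B _" "\<Union>k. B k"] by (intro span_sum span_scale) blast
  moreover have sum0: "?S (Suc m) w + ?S (Suc m) g = 0"
    using m unfolding eq linear_add[OF lin] .
  ultimately have w0: "?S (Suc m) w = 0"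
    using span_inter_generalised_0[of "?S (Suc m) w"]
      subspace_neg[OF subspace_generalised_eigenspace[OF T, of 0], of "?S (Suc m) g"]
    by (simp add: add_eq_0_iff2 eq_neg_iff_add_eq_0)
  with sum0 have "?S (Suc m) g = 0" by (metis add_0)
  then have "g = 0"
    using generalised_eigenspace_0_disjoint[OF T l_nonzero _ j] by blast
  have "(l i - l k) ^ Suc m *\<^sub>R v i = 0" if "i < n" for i
  proof (rule eigenvectors_sum_eq_0[OF T inj_l _ _ that])
    show "(l i - l k) ^ Suc m *\<^sub>R v i \<in> eigenspace T (l i)" for i
      by (rule subspace_scale[OF subspace_eigenspace[OF T] ve])
    show "(\<Sum>i<n. (l i - l k) ^ Suc m *\<^sub>R v i) = 0"
      using w0 unfolding Sw .
  qed
  then have "v i = 0" if "i < n" "i \<noteq> k" for i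
    using that injD[OF inj_l, of i k] by fastforce
  then have "w = (\<Sum>i<n. if i = k then v i else 0)"
    unfolding v(2) by (intro sum.cong) auto
  then show "x \<in> span (B k)"
    using v(1) eq \<open>g = 0\<close> by (auto simp: span_zero)
qed

lemma eigenspace_eq_span:
  assumes "decomposable_part = UNIV"
  shows "eigenspace T (l k) = span (B k)" "generalised_eigenspace T (l k) = eigenspace T (l k)"
proof -
  have "eigenspace T (l k) \<subseteq> generalised_eigenspace T (l k)"
    unfolding eigenspace_def generalised_eigenspace_def
    by (auto intro: exI[of _ 1])
  then show "eigenspace T (l k) = span (B k)" "generalised_eigenspace T (l k) = eigenspace T (l k)"
    using generalised_eigenspace_subset[OF assms, of k] span_eigen[of k] by auto
qed

end

section \<open>Auxiliary facts on spans, list sums and functionals\<close>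

lemma prod_list_in_span:
  fixes ps :: "'a::real_algebra_1 list"
  assumes "set ps \<subseteq> span E"
  shows "prod_list ps \<in> span (prod_list ` {qs. set qs \<subseteq> E \<and> length qs = length ps})"
  using assms
proof (induction ps)
  case Nil
  show ?case by (rule span_base, rule image_eqI[of _ _ "[]"]) auto
next
  case (Cons p ps)
  have "p * prod_list ps \<in> span (prod_list ` {qs. set qs \<subseteq> E \<and> length qs = length (p # ps)})"
  proof (rule mult_in_subspace)
    show "p \<in> span E" using Cons.prems by simp
    show "prod_list ps \<in> span (prod_list ` {qs. set qs \<subseteq> E \<and> length qs = length ps})"
      using Cons by simp
    fix e b assume "e \<in> E" "b \<in> prod_list ` {qs. set qs \<subseteq> E \<and> length qs = length ps}"
    then obtain qs where "b = prod_list qs" "set (e # qs) \<subseteq> E" "length (e # qs) = length (p # ps)"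
      by auto
    then have "e * b \<in> prod_list ` {qs. set qs \<subseteq> E \<and> length qs = length (p # ps)}"
      by (intro image_eqI[of _ _ "e # qs"]) auto
    then show "e * b \<in> span (prod_list ` {qs. set qs \<subseteq> E \<and> length qs = length (p # ps)})"
      by (rule span_base)
  qed simp
  then show ?case by simp
qed

lemma sum_list_scaleR_left:
  fixes v :: "'v::real_vector"
  shows "(\<Sum>x\<leftarrow>xs. c x *\<^sub>R v) = (\<Sum>x\<leftarrow>xs. c x) *\<^sub>R v"
  by (induction xs) (auto simp: scaleR_add_left)

lemma subspace_sum_list: "subspace V \<Longrightarrow> (\<And>x. x \<in> set xs \<Longrightarrow> h x \<in> V) \<Longrightarrow> (\<Sum>x\<leftarrow>xs. h x) \<in> V"
  by (induction xs) (auto intro: subspace_0 subspace_add)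

text \<open>A functional good for A is perturbed by t times one that is nonzero on the new vector.
  Only finitely many t are bad.\<close>

lemma ex_linear_functional_nonzero:
  fixes A :: "'a::real_vector set"
  assumes "finite A" "0 \<notin> A"
  shows "\<exists>\<phi>::'a \<Rightarrow> real. linear \<phi> \<and> (\<forall>x\<in>A. \<phi> x \<noteq> 0)"
  using assms
proof (induction A rule: finite_induct)
  case empty
  then show ?case using linear_zero by blast
next
  case (insert x A)
  then obtain \<phi> :: "'a \<Rightarrow> real" where \<phi>: "linear \<phi>" "\<And>y. y \<in> A \<Longrightarrow> \<phi> y \<noteq> 0" by auto
  have "independent {x}" using insert.prems by simp
  from linear_independent_extend[OF this, of "\<lambda>_. 1 :: real"]
  obtain \<psi> :: "'a \<Rightarrow> real" where \<psi>: "linear \<psi>" "\<psi> x = 1" by auto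
  obtain t where t: "t \<notin> (\<lambda>y. - \<phi> y / \<psi> y) ` insert x A"
    using ex_new_if_finite[OF infinite_UNIV_char_0, of "(\<lambda>y. - \<phi> y / \<psi> y) ` insert x A"] insert.hyps(1)
    by auto
  have "\<phi> y + t * \<psi> y \<noteq> 0" if "y \<in> insert x A" for y
  proof (cases "\<psi> y = 0")
    case True
    then show ?thesis using that \<phi>(2) \<psi>(2) by auto
  next
    case False
    show ?thesis
    proof
      assume "\<phi> y + t * \<psi> y = 0"
      then have "t = - \<phi> y / \<psi> y" using False by (simp add: field_simps)
      then show False using t that by auto
    qed
  qed
  moreover have "linear (\<lambda>y. \<phi> y + t * \<psi> y)"
    by (intro linear_intros \<phi> \<psi>)
  ultimately show ?case by blast
qed

section \<open>Linear independence of symmetrised products\<close>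

context real_bialgebra
begin

text \<open>A convolution product of \<open>k\<close> functionals that vanish at \<open>1\<close> annihilates products of fewer than
  \<open>k\<close> primitives and is a permanent on symmetrised products of exactly \<open>k\<close> of them. With functionals
  dual to \<open>P\<close> it therefore isolates the longest term of a linear relation.\<close>

primrec functional_conv :: "('a \<Rightarrow> real) list \<Rightarrow> 'a \<Rightarrow> real" where
  "functional_conv [] = \<epsilon>"
| "functional_conv (\<phi> # \<phi>s) = conv \<phi> (functional_conv \<phi>s)"

lemma linear_functional_conv:
  "(\<And>\<phi>. \<phi> \<in> set \<phi>s \<Longrightarrow> linear \<phi>) \<Longrightarrow> linear (functional_conv \<phi>s)"
  by (induction \<phi>s) (auto intro: linear_conv linear_counit)

text \<open>In the binomial expansion the index 0 dies because \<phi> 1 = 0, and an index of at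
  least 2 leaves too low a power for the remaining functionals. The surviving coefficients
  \<open>k choose 1\<close> multiply up to \<open>fact k\<close>.\<close>

lemma functional_conv_power:
  assumes p: "p \<in> primitives \<Delta>" and "\<And>\<phi>. \<phi> \<in> set \<phi>s \<Longrightarrow> linear \<phi> \<and> \<phi> 1 = 0"
  shows "(k < length \<phi>s \<longrightarrow> functional_conv \<phi>s (p ^ k) = 0) \<and>
    (k = length \<phi>s \<longrightarrow> functional_conv \<phi>s (p ^ k) = fact k * prod_list (map (\<lambda>\<phi>. \<phi> p) \<phi>s))"
  using assms(2)
proof (induction \<phi>s arbitrary: k)
  case Nil
  then show ?case by (simp add: counit_one)
next
  case (Cons \<phi> \<phi>s)
  let ?t = "\<lambda>i. real (k choose i) * (\<phi> (p ^ i) * functional_conv \<phi>s (p ^ (k - i)))"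
  have lin: "linear \<phi>" "linear (functional_conv \<phi>s)" "\<phi> 1 = 0"
    using Cons.prems by (auto intro!: linear_functional_conv)
  have eq: "functional_conv (\<phi> # \<phi>s) (p ^ k) = (\<Sum>i\<le>k. ?t i)"
    by (simp add: conv_def sw_primitive_power[OF p bilinear_conv[OF lin(1,2)]])
  have small: "functional_conv \<phi>s (p ^ j) = 0" if "j < length \<phi>s" for j
    using Cons that by simp
  have top: "functional_conv \<phi>s (p ^ length \<phi>s)
      = fact (length \<phi>s) * prod_list (map (\<lambda>\<phi>. \<phi> p) \<phi>s)"
    using Cons by simp
  have zero: "?t i = 0" if "k \<le> Suc (length \<phi>s)" "i \<le> k" "i \<noteq> 1 \<or> k < Suc (length \<phi>s)" for i
  proof (cases "i = 0")
    case False
    then have "k - i < length \<phi>s" using that by auto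
    then show ?thesis by (simp add: small)
  qed (simp add: lin(3))
  show ?case
  proof (intro conjI impI)
    assume "k < length (\<phi> # \<phi>s)"
    then show "functional_conv (\<phi> # \<phi>s) (p ^ k) = 0"
      unfolding eq by (intro sum.neutral ballI zero) auto
  next
    assume k: "k = length (\<phi> # \<phi>s)"
    have "(\<Sum>i\<le>k. ?t i) = (\<Sum>i\<in>{1}. ?t i)"
      using k by (intro sum.mono_neutral_right ballI zero) auto
    also have "\<dots> = fact k * prod_list (map (\<lambda>\<phi>. \<phi> p) (\<phi> # \<phi>s))"
      using k by (simp add: top)
    finally show "functional_conv (\<phi> # \<phi>s) (p ^ k) = fact k * prod_list (map (\<lambda>\<phi>. \<phi> p) (\<phi> # \<phi>s))"
      unfolding eq .
  qed
qed

text \<open>Polarisation is used twice: to reduce to powers of sums, and then backwards with h i j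
  the value of the i-th functional at the j-th primitive.\<close>

lemma functional_conv_sym_product:
  assumes qs: "set qs \<subseteq> primitives \<Delta>" and \<phi>s: "\<And>\<phi>. \<phi> \<in> set \<phi>s \<Longrightarrow> linear \<phi> \<and> \<phi> 1 = 0"
  shows "length qs < length \<phi>s \<Longrightarrow> functional_conv \<phi>s (sym_product qs) = 0"
    and "length qs = length \<phi>s \<Longrightarrow> functional_conv \<phi>s (sym_product qs) = fact (length qs) *
      (\<Sum>\<sigma> | \<sigma> permutes {..<length qs}. prod_list (map (\<lambda>i. (\<phi>s ! i) (qs ! \<sigma> i)) [0..<length qs]))"
proof -
  let ?k = "length qs"
  let ?q = "\<lambda>S. \<Sum>j\<in>S. qs ! j"
  have lin: "linear (functional_conv \<phi>s)" using \<phi>s by (intro linear_functional_conv) auto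
  have q: "?q S \<in> primitives \<Delta>" if "S \<in> Pow {..<?k}" for S
    using qs that nth_mem[of _ qs] by (intro subspace_sum subspace_primitives) blast
  have eq: "functional_conv \<phi>s (sym_product qs)
      = (\<Sum>S\<in>Pow {..<?k}. (- 1) ^ (?k + card S) * functional_conv \<phi>s (?q S ^ ?k))"
    unfolding sym_product_eq_sum_powers by (simp add: linear_sum[OF lin] linear_scale[OF lin])
  show "functional_conv \<phi>s (sym_product qs) = 0" if "?k < length \<phi>s"
    unfolding eq using functional_conv_power[OF q \<phi>s] that by (intro sum.neutral) auto
  assume len: "?k = length \<phi>s"
  have "functional_conv \<phi>s (?q S ^ ?k)
      = fact ?k * prod_list (map (\<lambda>i. \<Sum>j\<in>S. (\<phi>s ! i) (qs ! j)) [0..<?k])" if S: "S \<in> Pow {..<?k}" for S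
  proof -
    have "map (\<lambda>\<phi>. \<phi> (?q S)) \<phi>s = map (\<lambda>i. \<Sum>j\<in>S. (\<phi>s ! i) (qs ! j)) [0..<?k]"
      using \<phi>s by (intro nth_equalityI) (auto simp: len linear_sum)
    then show ?thesis using functional_conv_power[OF q[OF S], where \<phi>s = \<phi>s and k = ?k] \<phi>s len by simp
  qed
  then have "functional_conv \<phi>s (sym_product qs) = (\<Sum>S\<in>Pow {..<?k}. fact ?k *
      ((- 1) ^ (?k + card S) * prod_list (map (\<lambda>i. \<Sum>j\<in>S. (\<phi>s ! i) (qs ! j)) [0..<?k])))"
    unfolding eq by (intro sum.cong) auto
  then show "functional_conv \<phi>s (sym_product qs) = fact ?k *
      (\<Sum>\<sigma> | \<sigma> permutes {..<?k}. prod_list (map (\<lambda>i. (\<phi>s ! i) (qs ! \<sigma> i)) [0..<?k]))"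
    unfolding polarisation[where h = "\<lambda>i j. (\<phi>s ! i) (qs ! j)"] by (simp add: sum_distrib_left)
qed

text \<open>Normalises a functional at 1 without changing it on primitives, where the counit
  vanishes.\<close>

lemma functional_minus_counit:
  assumes "linear \<phi>"
  shows "linear (\<lambda>x. \<phi> x - \<phi> 1 * \<epsilon> x)" "\<phi> 1 - \<phi> 1 * \<epsilon> 1 = 0"
    "p \<in> primitives \<Delta> \<Longrightarrow> \<phi> p - \<phi> 1 * \<epsilon> p = \<phi> p"
  by (auto simp: counit_one counit_primitive intro!: linear_intros assms linear_counit)

text \<open>With the same functional in every slot, all terms of the permanent equal the product of
  its values, so nothing can cancel.\<close>

lemma sym_product_nonzero:
  assumes ps: "set ps \<subseteq> primitives \<Delta>" and "0 \<notin> set ps"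
  shows "sym_product ps \<noteq> 0"
proof
  let ?k = "length ps"
  assume zero: "sym_product ps = 0"
  obtain \<phi> :: "'a \<Rightarrow> real" where \<phi>: "linear \<phi>" "\<And>x. x \<in> set ps \<Longrightarrow> \<phi> x \<noteq> 0"
    using ex_linear_functional_nonzero[OF _ assms(2)] by auto
  define \<psi> where "\<psi> = (\<lambda>x. \<phi> x - \<phi> 1 * \<epsilon> x)"
  have \<psi>: "linear \<psi>" "\<psi> 1 = 0" "\<And>x. x \<in> set ps \<Longrightarrow> \<psi> x \<noteq> 0"
    using functional_minus_counit(1)[OF \<phi>(1)] \<phi>(2) ps by (auto simp: \<psi>_def counit_one counit_primitive subset_iff)
  let ?\<phi>s = "replicate ?k \<psi>"
  have lin: "linear (functional_conv ?\<phi>s)" using \<psi>(1) by (intro linear_functional_conv) auto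
  have "prod_list (map (\<lambda>i. (?\<phi>s ! i) (ps ! \<sigma> i)) [0..<?k]) = prod_list (map \<psi> ps)"
    if "\<sigma> permutes {..<?k}" for \<sigma>
  proof -
    have "map (\<lambda>i. (?\<phi>s ! i) (ps ! \<sigma> i)) [0..<?k] = map \<psi> (permute_list \<sigma> ps)"
      by (auto simp: permute_list_def)
    also have "prod_list \<dots> = prod_mset (image_mset \<psi> (mset (permute_list \<sigma> ps)))"
      by (simp only: prod_mset_prod_list[symmetric] mset_map)
    also have "\<dots> = prod_list (map \<psi> ps)"
      using that by (simp add: prod_mset_prod_list[symmetric])
    finally show ?thesis .
  qed
  then have "functional_conv ?\<phi>s (sym_product ps)
      = fact ?k * (\<Sum>\<sigma> | \<sigma> permutes {..<?k}. prod_list (map \<psi> ps))"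
    using \<psi> by (subst functional_conv_sym_product(2)[OF ps]) auto
  also have "\<dots> \<noteq> 0"
    using \<psi>(3) by (auto simp: card_permutations[OF refl] prod_list_zero_iff)
  finally show False using zero linear_0[OF lin] by simp
qed

lemma sym_product_relation_trivial:
  assumes P: "independent P" "P \<subseteq> primitives \<Delta>" and r: "antisym r"
    and L: "finite L" "L \<subseteq> ordered_lists P r"
    and rel: "(\<Sum>ps\<in>L. c ps *\<^sub>R sym_product ps) = 0" and qs: "qs \<in> L"
  shows "c qs = 0"
proof (rule ccontr)
  assume "c qs \<noteq> 0"
  define L' where "L' = {ps \<in> L. c ps \<noteq> 0}"
  have L': "finite L'" "L' \<noteq> {}" using L(1) qs \<open>c qs \<noteq> 0\<close> by (auto simp: L'_def)
  then have "Max (length ` L') \<in> length ` L'" by (intro Max_in) auto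
  then obtain ps where ps: "ps \<in> L'" "length ps = Max (length ` L')"
    by (metis imageE)
  have max: "length qs \<le> length ps" if "qs \<in> L'" for qs
    using L'(1) that ps(2) by simp
  have ol: "set qs \<subseteq> P" "sorted_wrt (\<lambda>x y. (x, y) \<in> r) qs" if "qs \<in> L'" for qs
    using that L(2) by (auto simp: L'_def ordered_lists_def)
  \<comment> \<open>Functionals dual to \<open>P\<close>, corrected by the counit so that they
    vanish at 1.\<close>
  have "\<exists>d::'a \<Rightarrow> real. linear d \<and> d 1 = 0 \<and> (\<forall>b'\<in>P. d b' = (if b' = b then 1 else 0))" for b
  proof -
    obtain d :: "'a \<Rightarrow> real" where d: "linear d" "\<forall>b'\<in>P. d b' = (if b' = b then 1 else 0)"
      using linear_independent_extend[OF P(1), of "\<lambda>b'. if b' = b then 1 else 0"] by auto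
    then show ?thesis
      using functional_minus_counit[OF d(1)] P(2) by (intro exI[of _ "\<lambda>x. d x - d 1 * \<epsilon> x"]) auto
  qed
  then obtain d :: "'a \<Rightarrow> 'a \<Rightarrow> real" where d: "\<And>b. linear (d b)" "\<And>b. d b 1 = 0"
    "\<And>b b'. b' \<in> P \<Longrightarrow> d b b' = (if b' = b then 1 else 0)"
    by metis
  let ?k = "length ps"
  let ?\<Phi> = "functional_conv (map d ps)"
  let ?t = "\<lambda>qs \<sigma>. prod_list (map (\<lambda>i. (map d ps ! i) (qs ! \<sigma> i)) [0..<length qs])"
  have \<phi>s: "\<phi> \<in> set (map d ps) \<Longrightarrow> linear \<phi> \<and> \<phi> 1 = 0" for \<phi> using d by auto
  have lin: "linear ?\<Phi>" using \<phi>s by (intro linear_functional_conv) auto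
  \<comment> \<open>By duality each term of the permanent is 0 or 1, and it is 1 only if \<sigma>
    rearranges \<open>qs\<close> into \<open>ps\<close>. For sorted lists this forces
    \<open>qs\<close> = \<open>ps\<close>.\<close>
  have t: "?t qs \<sigma> = (if permute_list \<sigma> qs = ps then 1 else 0)"
    if "qs \<in> L'" "length qs = ?k" "\<sigma> permutes {..<?k}" for qs \<sigma>
  proof -
    have mem: "qs ! \<sigma> i \<in> P" if "i < ?k" for i
      using ol(1)[OF \<open>qs \<in> L'\<close>] that permutes_in_image[OF \<open>\<sigma> permutes _\<close>, of i] \<open>length qs = ?k\<close>
      by (auto intro: nth_mem)
    have map: "map (\<lambda>i. (map d ps ! i) (qs ! \<sigma> i)) [0..<length qs]
        = map (\<lambda>i. if qs ! \<sigma> i = ps ! i then 1 else 0) [0..<?k]"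
      using that(2) by (auto simp: d(3)[OF mem])
    show ?thesis
    proof (cases "permute_list \<sigma> qs = ps")
      case True
      have "qs ! \<sigma> i = ps ! i" if "i < ?k" for i
        using arg_cong[OF True, of "\<lambda>l. l ! i"] that \<open>length qs = ?k\<close>
        by (simp add: permute_list_def)
      then have "map (\<lambda>i. if qs ! \<sigma> i = ps ! i then 1 else 0 :: real) [0..<?k] = replicate ?k 1"
        by (intro nth_equalityI) auto
      then show ?thesis using True by (simp add: map)
    next
      case False
      have "\<exists>i<?k. qs ! \<sigma> i \<noteq> ps ! i"
      proof (rule ccontr)
        assume "\<not> ?thesis"
        then have "permute_list \<sigma> qs = ps"
          using \<open>length qs = ?k\<close> by (intro nth_equalityI) (auto simp: permute_list_def)
        then show False using False by simp
      qed
      then obtain i where "i < ?k" "qs ! \<sigma> i \<noteq> ps ! i" by blast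
      then show ?thesis using False by (auto simp: map prod_list_zero_iff)
    qed
  qed
  have other: "?\<Phi> (sym_product qs) = 0" if "qs \<in> L'" "qs \<noteq> ps" for qs
  proof (cases "length qs < ?k")
    case True
    then show ?thesis
      using functional_conv_sym_product(1)[of qs "map d ps"] \<phi>s ol(1)[OF that(1)] P(2) by auto
  next
    case False
    then have len: "length qs = ?k" using max[OF that(1)] by simp
    have "?t qs \<sigma> = 0" if "\<sigma> permutes {..<length qs}" for \<sigma>
    proof -
      have "permute_list \<sigma> qs \<noteq> ps"
        using sorted_wrt_mset_unique[OF r ol(2)[OF \<open>qs \<in> L'\<close>] ol(2)[OF ps(1)]] that \<open>qs \<noteq> ps\<close>
        by (metis mset_permute_list)
      then show ?thesis using t[OF \<open>qs \<in> L'\<close> len] that len by simp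
    qed
    then show ?thesis
      using functional_conv_sym_product(2)[of qs "map d ps"] \<phi>s ol(1)[OF that(1)] P(2) len by auto
  qed
  \<comment> \<open>Repeated entries of \<open>ps\<close> let several permutations contribute, so
    only positivity is claimed. The identity permutation guarantees it.\<close>
  have "(\<Sum>\<sigma> | \<sigma> permutes {..<?k}. ?t ps \<sigma>) \<ge> ?t ps id"
    using t[OF ps(1) refl] by (intro member_le_sum[of id _ "?t ps"]) (auto simp: permutes_id finite_permutations)
  then have "(\<Sum>\<sigma> | \<sigma> permutes {..<?k}. ?t ps \<sigma>) > 0"
    using t[OF ps(1) refl permutes_id] by (simp add: permute_list_id)
  then have pos: "?\<Phi> (sym_product ps) > 0"
    using functional_conv_sym_product(2)[of ps "map d ps"] \<phi>s ol(1)[OF ps(1)] P(2) by auto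
  have "0 = ?\<Phi> (\<Sum>ps\<in>L. c ps *\<^sub>R sym_product ps)"
    by (simp only: rel linear_0[OF lin])
  also have "\<dots> = (\<Sum>ps\<in>L. c ps * ?\<Phi> (sym_product ps))"
    by (simp add: linear_sum[OF lin] linear_scale[OF lin])
  also have "\<dots> = (\<Sum>ps\<in>L'. c ps * ?\<Phi> (sym_product ps))"
    using L(1) by (intro sum.mono_neutral_right) (auto simp: L'_def)
  also have "\<dots> = (\<Sum>qs\<in>{ps}. c qs * ?\<Phi> (sym_product qs))"
    using L'(1) ps(1) other by (intro sum.mono_neutral_right) auto
  finally show False using pos ps(1) by (auto simp: L'_def)
qed

text \<open>Relations are indexed by lists rather than by values, so they also give injectivity: a
  coincidence is a relation with coefficients 1 and -1.\<close>

lemma sym_product_independent: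
  assumes "independent P" "P \<subseteq> primitives \<Delta>" "antisym r"
  shows "inj_on sym_product (ordered_lists P r)" "independent (sym_product ` ordered_lists P r)"
proof -
  note rel = sym_product_relation_trivial[OF assms]
  show inj: "inj_on sym_product (ordered_lists P r)"
  proof (rule inj_onI, rule ccontr)
    fix ps qs assume *: "ps \<in> ordered_lists P r" "qs \<in> ordered_lists P r"
      "sym_product ps = sym_product qs" "ps \<noteq> qs"
    have "(if ps = ps then 1 else - 1 :: real) = 0"
      by (rule rel[of "{ps, qs}" "\<lambda>x. if x = ps then 1 else - 1" ps]) (use * in auto)
    then show False by simp
  qed
  show "independent (sym_product ` ordered_lists P r)"
  proof
    assume "dependent (sym_product ` ordered_lists P r)"
    then obtain t u v where t: "finite t" "t \<subseteq> sym_product ` ordered_lists P r"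
      "(\<Sum>v\<in>t. u v *\<^sub>R v) = 0" "v \<in> t" "u v \<noteq> 0"
      unfolding dependent_explicit by blast
    obtain L where L: "L \<subseteq> ordered_lists P r" "finite L" "t = sym_product ` L"
      using finite_subset_image[OF t(1,2)] by blast
    obtain ps where ps: "ps \<in> L" "v = sym_product ps" using t(4) L(3) by auto
    have "(\<Sum>ps\<in>L. u (sym_product ps) *\<^sub>R sym_product ps) = 0"
      using t(3) unfolding L(3) by (subst (asm) sum.reindex[OF inj_on_subset[OF inj L(1)]]) simp
    from rel[OF L(2,1) this ps(1)] show False using t(5) ps(2) by simp
  qed
qed

end

section \<open>Leading symbols\<close>

context graded_connected_hopf_algebra
begin

lemma gen_filtration_mult_primitive:
  assumes "p \<in> primitives \<Delta>" "x \<in> gen_filtration k"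
  shows "p * x \<in> gen_filtration (Suc k)"
  using gen_filtration_mult(2)[OF assms(2), of p 1] prod_list_in_gen_filtration[of "[p]" 2] assms(1)
  by (simp add: numeral_2_eq_2)

text \<open>Moving p past one factor costs a commutator. It is again primitive, so the error is a
  word with one factor fewer.\<close>

lemma prod_list_move_front:
  assumes "set (l @ p # r) \<subseteq> primitives \<Delta>"
  shows "prod_list (l @ p # r) - p * prod_list (l @ r) \<in> gen_filtration (length (l @ p # r))"
  using assms
proof (induction l)
  case Nil
  then show ?case by (simp add: subspace_0[OF subspace_gen_filtration])
next
  case (Cons x l)
  have "x * (prod_list (l @ p # r) - p * prod_list (l @ r)) \<in> gen_filtration (length (x # l @ p # r))"
    using Cons gen_filtration_mult_primitive[of x] by simp
  moreover have "prod_list ((x * p - p * x) # l @ r) \<in> gen_filtration (length (x # l @ p # r))"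
    using Cons.prems primitive_commutator[of x p] by (intro prod_list_in_gen_filtration) auto
  ultimately have "x * (prod_list (l @ p # r) - p * prod_list (l @ r))
      + prod_list ((x * p - p * x) # l @ r) \<in> gen_filtration (length (x # l @ p # r))"
    by (rule subspace_add[OF subspace_gen_filtration])
  then show ?case
    by (simp add: algebra_simps)
qed

text \<open>Commutativity of the associated graded algebra, in terms of words.\<close>

lemma prod_list_permute:
  assumes "mset ps = mset qs" "set ps \<subseteq> primitives \<Delta>"
  shows "prod_list ps - prod_list qs \<in> gen_filtration (length ps)"
  using assms
proof (induction ps arbitrary: qs)
  case Nil
  then show ?case by (simp add: subspace_0[OF subspace_gen_filtration])
next
  case (Cons p ps)
  then obtain l r where qs: "qs = l @ p # r"
    using mset_eq_setD[OF Cons.prems(1)] split_list[of p qs] by auto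
  have "p * (prod_list ps - prod_list (l @ r)) \<in> gen_filtration (length (p # ps))"
    using Cons.prems Cons.IH[of "l @ r"] qs gen_filtration_mult_primitive[of p] by simp
  moreover have "set (l @ p # r) \<subseteq> primitives \<Delta>"
    using Cons.prems(2) mset_eq_setD[OF Cons.prems(1)] qs by auto
  then have "prod_list qs - p * prod_list (l @ r) \<in> gen_filtration (length (p # ps))"
    using prod_list_move_front[of l p r] mset_eq_length[OF Cons.prems(1)] qs by simp
  ultimately have "p * (prod_list ps - prod_list (l @ r)) - (prod_list qs - p * prod_list (l @ r))
      \<in> gen_filtration (length (p # ps))"
    by (rule subspace_diff[OF subspace_gen_filtration])
  then show ?case by (simp add: algebra_simps)
qed

text \<open>A splitting (l, r) of \<open>ps\<close> contributes the scalar of l times that of r,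
  since l @ r is a rearrangement of \<open>ps\<close>. Summed over all splittings, these scalars
  form the product of \<alpha> p + \<beta> p.\<close>

lemma conv_symbol:
  assumes E: "E \<subseteq> primitives \<Delta>" and lin: "linear f" "linear g"
    and f: "\<And>ps. set ps \<subseteq> E \<Longrightarrow>
      f (prod_list ps) - prod_list (map \<alpha> ps) *\<^sub>R prod_list ps \<in> gen_filtration (length ps)"
    and g: "\<And>ps. set ps \<subseteq> E \<Longrightarrow>
      g (prod_list ps) - prod_list (map \<beta> ps) *\<^sub>R prod_list ps \<in> gen_filtration (length ps)"
    and ps: "set ps \<subseteq> E"
  shows "conv f g (prod_list ps) - prod_list (map (\<lambda>p. \<alpha> p + \<beta> p) ps) *\<^sub>R prod_list ps
    \<in> gen_filtration (length ps)"
proof -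
  let ?G = "gen_filtration (length ps)"
  let ?c = "\<lambda>(l, r). prod_list (map \<alpha> l) * prod_list (map \<beta> r)"
  have "conv f g (prod_list ps) = (\<Sum>(l, r)\<leftarrow>splits ps. f (prod_list l) * g (prod_list r))"
    unfolding conv_def using ps E by (intro sw_prod_list bilinear_conv lin) auto
  moreover have "prod_list (map (\<lambda>p. \<alpha> p + \<beta> p) ps) *\<^sub>R prod_list ps
      = (\<Sum>x\<leftarrow>splits ps. ?c x *\<^sub>R prod_list ps)"
    unfolding sum_list_scaleR_left sum_splits_prod ..
  ultimately have "conv f g (prod_list ps) - prod_list (map (\<lambda>p. \<alpha> p + \<beta> p) ps) *\<^sub>R prod_list ps
      = (\<Sum>x\<leftarrow>splits ps. (case x of (l, r) \<Rightarrow> f (prod_list l) * g (prod_list r)) - ?c x *\<^sub>R prod_list ps)"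
    by (simp add: sum_list_subtractf)
  also have "\<dots> \<in> ?G"
  proof (rule subspace_sum_list[OF subspace_gen_filtration])
    fix x assume mem: "x \<in> set (splits ps)"
    obtain l r where x: "x = (l, r)" by (cases x)
    have m: "mset l + mset r = mset ps"
      using mem unfolding x by (rule mset_splits)
    have set: "set l \<union> set r = set ps" and len: "length l + length r = length ps"
      using arg_cong[OF m, of set_mset] arg_cong[OF m, of size] by auto
    have lr: "set l \<subseteq> E" "set r \<subseteq> E" using set ps by auto
    let ?a = "prod_list (map \<alpha> l)" and ?b = "prod_list (map \<beta> r)"
    let ?u = "f (prod_list l) - ?a *\<^sub>R prod_list l" and ?v = "g (prod_list r) - ?b *\<^sub>R prod_list r"
    have full: "prod_list qs \<in> gen_filtration (Suc (length qs))" if "set qs \<subseteq> E" for qs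
      using that E by (intro prod_list_in_gen_filtration) auto
    have "?v \<in> gen_filtration (Suc (length r))"
      using g[OF lr(2)] gen_filtration_mono[of "length r" "Suc (length r)"] by auto
    from subspace_add[OF subspace_gen_filtration this
        subspace_scale[OF subspace_gen_filtration full[OF lr(2)], of ?b]]
    have "g (prod_list r) \<in> gen_filtration (Suc (length r))" by simp
    from gen_filtration_mult(1)[OF f[OF lr(1)] this] have 1: "?u * g (prod_list r) \<in> ?G"
      by (simp only: len)
    have "prod_list l * ?v \<in> ?G"
      using gen_filtration_mult(2)[OF g[OF lr(2)] full[OF lr(1)]]
      by (simp only: len add.commute[of "length r"])
    then have 2: "?a *\<^sub>R (prod_list l * ?v) \<in> ?G"
      by (rule subspace_scale[OF subspace_gen_filtration])
    have "prod_list (l @ r) - prod_list ps \<in> gen_filtration (length (l @ r))"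
      using m set ps E by (intro prod_list_permute) auto
    then have 3: "(?a * ?b) *\<^sub>R (prod_list (l @ r) - prod_list ps) \<in> ?G"
      using len by (intro subspace_scale[OF subspace_gen_filtration]) simp
    \<comment> \<open>Three replacements, each of lower order: f by its symbol, g by its symbol, and
      l @ r by \<open>ps\<close>.\<close>
    have "f (prod_list l) * g (prod_list r) - (?a * ?b) *\<^sub>R prod_list ps
        = ?u * g (prod_list r) + ?a *\<^sub>R (prod_list l * ?v)
          + (?a * ?b) *\<^sub>R (prod_list (l @ r) - prod_list ps)"
      by (simp add: algebra_simps)
    also have "\<dots> \<in> ?G"
      by (intro subspace_add[OF subspace_gen_filtration] 1 2 3)
    finally show "(case x of (l, r) \<Rightarrow> f (prod_list l) * g (prod_list r)) - ?c x *\<^sub>R prod_list ps \<in> ?G"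
      by (simp add: x)
  qed
  finally show ?thesis .
qed

text \<open>All k! rearrangements agree to leading order, so products and symmetrised products can
  be exchanged in the induction on length.\<close>

lemma sym_product_symbol:
  assumes "set ps \<subseteq> primitives \<Delta>"
  shows "sym_product ps - fact (length ps) *\<^sub>R prod_list ps \<in> gen_filtration (length ps)"
proof -
  let ?S = "{\<sigma>. \<sigma> permutes {..<length ps}}"
  have "sym_product ps - fact (length ps) *\<^sub>R prod_list ps
      = (\<Sum>\<sigma>\<in>?S. prod_list (permute_list \<sigma> ps) - prod_list ps)"
    by (simp add: sym_product_eq_permute_list sum_subtractf card_permutations[OF refl]
        sum_constant_scaleR del: sum_constant)
  also have "\<dots> \<in> gen_filtration (length ps)"
  proof (intro subspace_sum subspace_gen_filtration)
    fix \<sigma> assume "\<sigma> \<in> ?S"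
    then have "mset (permute_list \<sigma> ps) = mset ps" by simp
    from prod_list_permute[OF this] mset_eq_setD[OF this] assms
    show "prod_list (permute_list \<sigma> ps) - prod_list ps \<in> gen_filtration (length ps)" by simp
  qed
  finally show ?thesis .
qed

end

section \<open>Alternating convolution powers of an involution\<close>

locale hopf_involution = graded_connected_hopf_algebra \<Delta> \<epsilon> S H
  for \<Delta> :: "'a::real_algebra_1 \<Rightarrow> 'a tensor_algebra" and \<epsilon> S H +
  fixes \<tau> :: "'a \<Rightarrow> 'a"
  assumes linear_inv: "linear \<tau>"
    and inv_inv: "\<tau> (\<tau> x) = x"
    and inv_mult: "\<tau> (x * y) = \<tau> x * \<tau> y"
    and inv_coalgebra: "coalgebra_morphism \<Delta> \<tau> \<or> coalgebra_antimorphism \<Delta> \<tau>"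
begin

text \<open>Preservation of the unit follows from surjectivity: \<tau> 1 is a unit for the image of
  \<tau>.\<close>

lemma inv_one: "\<tau> 1 = 1"
proof -
  have "1 = \<tau> (1 * \<tau> 1)" by (simp add: inv_inv)
  also have "\<dots> = \<tau> 1" by (simp only: inv_mult inv_inv mult_1_right)
  finally show ?thesis by simp
qed

text \<open>The coproduct of a primitive is invariant under the swap, so morphisms and antimorphisms
  are treated alike. The coalgebra hypothesis on \<tau> enters here.\<close>

lemma inv_primitive:
  assumes "p \<in> primitives \<Delta>" shows "\<tau> p \<in> primitives \<Delta>"
proof -
  have p: "\<Delta> p = pure_tensor [1, p] + pure_tensor [p, 1]"
    using assms by (simp add: primitives_def)
  have map: "tensor_map [\<tau>, \<tau>] (pure_tensor [x, y]) = pure_tensor [\<tau> x, \<tau> y]" for x y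
    using tensor_map_pure[of "[\<tau>, \<tau>]" "[x, y]"] linear_inv by simp
  have lin: "linear (tensor_map [\<tau>, \<tau>])"
    using linear_inv by (intro linear_tensor_map) auto
  show ?thesis
    using inv_coalgebra
    by (auto simp: primitives_def coalgebra_morphism_def coalgebra_antimorphism_def p map inv_one
        linear_add[OF lin] linear_add[OF linear_tensor_swap] tensor_swap_pure add.commute)
qed

abbreviation inv_primitives :: "'a set" where
  "inv_primitives \<equiv> primitives \<Delta> \<inter> eigenspace \<tau> 1"

lemma subspace_inv_primitives: "subspace inv_primitives"
  by (intro subspace_inter subspace_primitives subspace_eigenspace linear_inv)

lemma inv_power: "\<tau> (p ^ k) = \<tau> p ^ k"
  by (induction k) (auto simp: inv_one inv_mult)

text \<open>The Boolean s selects the pattern: True puts the identity in slot 0, as in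
  \<open>tau_plus\<close>, and False puts \<tau> there, as in \<open>tau_minus\<close>.\<close>

definition alternating :: "(nat \<Rightarrow> 'a \<Rightarrow> 'a) \<Rightarrow> bool" where
  "alternating F \<longleftrightarrow> (\<exists>s. F = (\<lambda>i. if even i = s then (\<lambda>x. x) else \<tau>))"

lemma tau_ops_eq_multi_op:
  assumes "T \<in> {tau_plus \<Delta> \<tau> a, tau_minus \<Delta> \<tau> a}"
  shows "\<exists>F. alternating F \<and> T = multi_op F a"
proof -
  have "tau_plus \<Delta> \<tau> a = multi_op (\<lambda>i. if even i = True then (\<lambda>x. x) else \<tau>) a"
    "tau_minus \<Delta> \<tau> a = multi_op (\<lambda>i. if even i = False then (\<lambda>x. x) else \<tau>) a"
    unfolding tau_plus_def tau_minus_def multi_op_def id_def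
    by (auto intro!: arg_cong[where f = "\<lambda>fs. mult_map \<circ> tensor_map fs \<circ> iterated_coproduct \<Delta> a"])
  then show ?thesis using assms unfolding alternating_def by blast
qed

lemma alternating_cases: "alternating F \<Longrightarrow> F i = (\<lambda>x. x) \<or> F i = \<tau>"
  by (auto simp: alternating_def)

lemma linear_alternating: "alternating F \<Longrightarrow> linear (F i)"
  using alternating_cases[of F i] linear_inv linear_ident by auto

lemma multi_op_power:
  assumes F: "alternating F" and a: "2 \<le> a" and p: "p \<in> inv_primitives"
  shows "multi_op F a (p ^ k) = real a ^ k *\<^sub>R p ^ k"
proof -
  have tp: "\<tau> (p ^ k) = p ^ k" for k
    using p by (simp add: inv_power eigenspace_def)
  \<comment> \<open>The identity and \<tau> agree on powers of p, so every slot has weight 1 and the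
    weights add up to \<open>a\<close>.\<close>
  let ?Q = "\<lambda>f \<alpha>. \<forall>k. f (p ^ k) = \<alpha> ^ k *\<^sub>R p ^ k"
  have "linear (multi_op F a) \<and> ?Q (multi_op F a) (\<Sum>i<a. 1)"
  proof (rule multi_op_induct[OF linear_alternating[OF F] a])
    show "?Q (F i) 1" for i
      using alternating_cases[OF F, of i] by (elim disjE) (simp_all add: tp)
    show "?Q (conv f g) (v + w)" if "linear f" "linear g" "?Q f v" "?Q g w" for f g v w
      using that p by (auto intro!: conv_power)
  qed
  then show ?thesis by simp
qed

lemma linear_multi_op:
  assumes "alternating F" "2 \<le> a" shows "linear (multi_op F a)"
  using multi_op_induct[of F a "\<lambda>_ _. True" "\<lambda>_. 0::nat"] linear_alternating[OF assms(1)] assms(2)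
  by simp

lemma multi_op_sym_product:
  assumes F: "alternating F" and a: "2 \<le> a" and ps: "set ps \<subseteq> inv_primitives"
  shows "sym_product ps \<in> eigenspace (multi_op F a) (real a ^ length ps)"
proof -
  let ?k = "length ps"
  have "(\<Sum>j\<in>S. ps ! j) \<in> inv_primitives" if "S \<in> Pow {..<?k}" for S
    using ps that nth_mem[of _ ps] by (intro subspace_sum subspace_inv_primitives) blast
  then have "multi_op F a (sym_product ps) = (\<Sum>S\<in>Pow {..<?k}. (- 1) ^ (?k + card S) *\<^sub>R
      (real a ^ ?k *\<^sub>R (\<Sum>j\<in>S. ps ! j) ^ ?k))"
    unfolding sym_product_eq_sum_powers
    by (simp add: linear_sum[OF linear_multi_op[OF F a]] linear_scale[OF linear_multi_op[OF F a]]
        multi_op_power[OF F a] del: Int_iff)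
  also have "\<dots> = real a ^ ?k *\<^sub>R sym_product ps"
    unfolding sym_product_eq_sum_powers by (simp add: scaleR_sum_right mult.commute)
  finally show ?thesis by (simp add: eigenspace_def)
qed

lemma multi_op_symbol:
  assumes F: "alternating F" and a: "2 \<le> a" "even a"
    and ps: "set ps \<subseteq> primitives \<Delta>" "\<And>p. p \<in> set ps \<Longrightarrow> \<tau> p = p \<or> \<tau> p = - p"
  shows "multi_op F a (prod_list ps)
    - prod_list (map (\<lambda>p. if \<tau> p = p then real a else 0) ps) *\<^sub>R prod_list ps \<in> gen_filtration (length ps)"
proof -
  let ?E = "{p \<in> primitives \<Delta>. \<tau> p = p \<or> \<tau> p = - p}"
  \<comment> \<open>A weight is a pair of scalars, one for invariant and one for anti-invariant
    factors, so that a single induction over the slots treats mixed words.\<close>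
  define sg where "sg = (\<lambda>(v::real \<times> real) p. if \<tau> p = p then fst v else snd v)"
  let ?Q = "\<lambda>f v. \<forall>ps. set ps \<subseteq> ?E \<longrightarrow>
      f (prod_list ps) - prod_list (map (sg v) ps) *\<^sub>R prod_list ps \<in> gen_filtration (length ps)"
  obtain s where s: "F = (\<lambda>i. if even i = s then (\<lambda>x. x) else \<tau>)"
    using F by (auto simp: alternating_def)
  let ?w = "\<lambda>i::nat. (1 :: real, if even i = s then 1 else - 1 :: real)"
  have tau: "\<tau> (prod_list ps) = prod_list (map (sg (1, - 1)) ps) *\<^sub>R prod_list ps"
    if "set ps \<subseteq> ?E" for ps
    using that by (induction ps) (auto simp: inv_one inv_mult sg_def)
  have ident: "prod_list (map (sg (1, 1)) ps) = 1" for ps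
    by (induction ps) (auto simp: sg_def)
  have "linear (multi_op F a) \<and> ?Q (multi_op F a) (\<Sum>i<a. ?w i)"
  proof (rule multi_op_induct[OF linear_alternating[OF F] a(1)])
    show "?Q (F i) (?w i)" for i
      using subspace_0[OF subspace_gen_filtration] by (auto simp: s tau ident)
    show "?Q (conv f g) (v + w)" if "linear f" "linear g" "?Q f v" "?Q g w" for f g v w
    proof (intro allI impI)
      fix ps assume "set ps \<subseteq> ?E"
      then have "conv f g (prod_list ps) - prod_list (map (\<lambda>p. sg v p + sg w p) ps) *\<^sub>R prod_list ps
          \<in> gen_filtration (length ps)"
        using that by (intro conv_symbol[where E = ?E]) auto
      moreover have "sg (v + w) = (\<lambda>p. sg v p + sg w p)"
        by (auto simp: sg_def)
      ultimately show "conv f g (prod_list ps) - prod_list (map (sg (v + w)) ps) *\<^sub>R prod_list ps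
          \<in> gen_filtration (length ps)" by simp
    qed
  qed
  \<comment> \<open>Evenness of \<open>a\<close> enters here: the anti-invariant weights 1 and -1
    alternate and cancel.\<close>
  moreover have "(\<Sum>i<a. ?w i) = (real a, 0)"
  proof -
    obtain b where b: "a = 2 * b" using a(2) by blast
    have "(\<Sum>i<2 * b. if even i = s then 1 else - 1 :: real) = 0"
      by (induction b) auto
    then show ?thesis
      by (intro prod_eqI) (simp_all add: fst_sum snd_sum b)
  qed
  ultimately have Q: "?Q (multi_op F a) (real a, 0)" by simp
  have sg: "sg (real a, 0) = (\<lambda>p. if \<tau> p = p then real a else 0)"
    by (simp add: sg_def fun_eq_iff)
  have "set ps \<subseteq> ?E" using ps by auto
  from Q[rule_format, OF this] show ?thesis by (simp only: sg)
qed

lemma primitives_subset_span: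
  assumes "span P = inv_primitives"
  shows "primitives \<Delta> \<subseteq> span (P \<union> {p \<in> primitives \<Delta>. \<tau> p = - p})"
proof
  fix p assume p: "p \<in> primitives \<Delta>"
  let ?u = "(1/2) *\<^sub>R (p + \<tau> p)" and ?v = "(1/2) *\<^sub>R (p - \<tau> p)"
  note prim = subspace_add[OF subspace_primitives] subspace_diff[OF subspace_primitives]
    subspace_scale[OF subspace_primitives]
  have "?u \<in> inv_primitives"
    using p inv_primitive[OF p]
    by (auto simp: eigenspace_def linear_scale[OF linear_inv] linear_add[OF linear_inv] inv_inv
        add.commute intro!: prim)
  then have "?u \<in> span (P \<union> {p \<in> primitives \<Delta>. \<tau> p = - p})"
    using assms span_mono[of P] by blast
  moreover have "?v \<in> {p \<in> primitives \<Delta>. \<tau> p = - p}"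
    using p inv_primitive[OF p]
    by (auto simp: linear_scale[OF linear_inv] linear_diff[OF linear_inv] inv_inv algebra_simps
        intro!: prim)
  then have "?v \<in> span (P \<union> {p \<in> primitives \<Delta>. \<tau> p = - p})"
    by (intro span_base) blast
  moreover have "p = ?u + ?v"
    by (simp add: algebra_simps flip: scaleR_add_left)
  ultimately show "p \<in> span (P \<union> {p \<in> primitives \<Delta>. \<tau> p = - p})"
    using span_add by metis
qed

lemma multi_op_spectrum:
  assumes F: "alternating F" and a: "2 \<le> a" "even a" and cc: "cocommutative \<Delta>"
    and P: "basis_of P inv_primitives" and r: "linear_order_on P r"
  defines "B \<equiv> \<lambda>k. sym_product ` {ps \<in> ordered_lists P r. length ps = k}"
  shows "eigenspace (multi_op F a) (real a ^ k) = span (B k)"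
    "generalised_eigenspace (multi_op F a) (real a ^ k) = eigenspace (multi_op F a) (real a ^ k)"
    "complementary (span (\<Union>k. B k)) (generalised_eigenspace (multi_op F a) 0)"
proof -
  let ?T = "multi_op F a"
  have spanP: "span P = inv_primitives"
    using P by (simp add: basis_of_def)
  have PI: "P \<subseteq> inv_primitives" using spanP span_superset by blast
  interpret eigen_family ?T "\<lambda>k. real a ^ k" B
  proof (rule eigen_family.intro)
    show "linear ?T" by (rule linear_multi_op[OF F a(1)])
    show "inj (\<lambda>k. real a ^ k)"
      using a(1) by (intro injI) (simp add: power_inject_exp)
    show "real a ^ k \<noteq> 0" for k using a(1) by simp
    show "B k \<subseteq> eigenspace ?T (real a ^ k)" for k
      using PI multi_op_sym_product[OF F a(1)] by (auto simp: B_def ordered_lists_def)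
  qed
  note SP = subspace_decomposable_part
  have zero: "0 \<in> generalised_eigenspace ?T 0"
    by (rule subspace_0[OF subspace_generalised_eigenspace[OF T]])
  have BSP: "B k \<subseteq> decomposable_part" for k
    unfolding decomposable_part_def using zero span_base[of _ "\<Union>k. B k"] by force
  let ?E = "P \<union> {p \<in> primitives \<Delta>. \<tau> p = - p}"
  have eigen_prod: "prod_list qs \<in> decomposable_part"
    if IH: "gen_filtration (length qs) \<subseteq> decomposable_part" and qs: "set qs \<subseteq> ?E" for qs
  proof -
    have qs': "set qs \<subseteq> primitives \<Delta>" "\<And>q. q \<in> set qs \<Longrightarrow> \<tau> q = q \<or> \<tau> q = - q"
      using qs PI by (auto simp: eigenspace_def)
    \<comment> \<open>The vector 0 is both invariant and anti-invariant and lies outside the basis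
      \<open>P\<close>, so it needs its own case. Any other anti-invariant factor is moved by
      \<tau>.\<close>
    consider "0 \<in> set qs" | q where "q \<in> set qs" "\<tau> q \<noteq> q" | "set qs \<subseteq> P"
    proof (cases "set qs \<subseteq> P")
      case False
      then obtain q where q: "q \<in> set qs" "\<tau> q = - q" using qs by auto
      show ?thesis
      proof (cases "\<tau> q = q")
        case True
        then have "q = - q" using q(2) by simp
        then have "2 *\<^sub>R q = 0" by (simp only: scaleR_2 eq_neg_iff_add_eq_0)
        then have "q = 0" by simp
        then show ?thesis using q(1) that(1) by simp
      qed (use q that in blast)
    qed (use that in blast)
    then show ?thesis
    proof cases
      case 1
      then have "prod_list qs = 0" by (auto dest!: split_list)
      then show ?thesis using subspace_0[OF SP] by simp
    next
      \<comment> \<open>The factor q makes the leading scalar 0, so \<open>?T\<close> lowers the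
        order. The hypothesis covers the image, and \<open>decomposable_part_preimage\<close> then
        covers the product.\<close>
      case (2 q)
      then have "prod_list (map (\<lambda>p. if \<tau> p = p then real a else 0) qs) = 0"
        by (auto simp: prod_list_zero_iff image_iff intro!: bexI[of _ q])
      then have "?T (prod_list qs) \<in> gen_filtration (length qs)"
        using multi_op_symbol[OF F a qs'] by simp
      then show ?thesis using IH decomposable_part_preimage by blast
    next
      \<comment> \<open>Up to lower order the word is a multiple of its symmetrised product. That
        product depends only on the multiset of factors, so sorting puts it into
        \<open>B ?k\<close>.\<close>
      case 3
      let ?k = "length qs"
      obtain qs'' where sorted: "mset qs'' = mset qs" "sorted_wrt (\<lambda>x y. (x, y) \<in> r) qs''"
        using ex_sorted_permutation[OF r 3] by blast
      have "qs'' \<in> ordered_lists P r" "length qs'' = ?k"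
        using sorted 3 mset_eq_setD[OF sorted(1)] mset_eq_length[OF sorted(1)]
        by (auto simp: ordered_lists_def)
      then have "sym_product qs'' \<in> B ?k" by (auto simp: B_def)
      then have "sym_product qs \<in> decomposable_part"
        using BSP sym_product_cong_mset[OF sorted(1)] by auto
      moreover have "sym_product qs - fact ?k *\<^sub>R prod_list qs \<in> decomposable_part"
        using sym_product_symbol[OF qs'(1)] IH by blast
      ultimately have "sym_product qs - (sym_product qs - fact ?k *\<^sub>R prod_list qs) \<in> decomposable_part"
        by (rule subspace_diff[OF SP])
      from subspace_scale[OF SP this, of "1 / fact ?k"] show ?thesis by simp
    qed
  qed
  have "gen_filtration n \<subseteq> decomposable_part" for n
  proof (induction n)
    case 0
    then show ?case using subspace_0[OF SP] by (simp add: gen_filtration_def)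
  next
    case (Suc n)
    \<comment> \<open>Only words of length exactly n are new at this stage. Their factors expand
      into \<tau>-eigenvectors, which reduces them to \<open>eigen_prod\<close>.\<close>
    have "prod_list ps \<in> decomposable_part" if ps: "set ps \<subseteq> primitives \<Delta>" "length ps < Suc n" for ps
    proof (cases "length ps = n")
      case True
      have "prod_list ps \<in> span (prod_list ` {qs. set qs \<subseteq> ?E \<and> length qs = length ps})"
        using ps(1) primitives_subset_span[OF spanP] by (intro prod_list_in_span) blast
      also have "\<dots> \<subseteq> decomposable_part"
        using Suc True by (intro span_minimal SP) (auto intro!: eigen_prod)
      finally show ?thesis .
    next
      case False
      then show ?thesis
        using Suc prod_list_in_gen_filtration[OF ps(1), of n] ps(2) by auto
    qed
    then show ?case
      unfolding gen_filtration_def by (intro span_minimal SP) auto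
  qed
  then have "decomposable_part = UNIV"
    using generated_by_primitives[OF cc] by blast
  then show "eigenspace ?T (real a ^ k) = span (B k)"
    "generalised_eigenspace ?T (real a ^ k) = eigenspace ?T (real a ^ k)"
    "complementary (span (\<Union>k. B k)) (generalised_eigenspace ?T 0)"
    by (rule eigenspace_eq_span complementary_span)+
qed

end

theorem theorem3p6:
  fixes \<Delta> :: "'a::real_algebra_1 \<Rightarrow> 'a tensor_algebra"
    and \<epsilon> :: "'a \<Rightarrow> real"
    and S :: "'a \<Rightarrow> 'a"
    and H :: "nat \<Rightarrow> 'a set"
    and \<tau> :: "'a \<Rightarrow> 'a"
    and a :: nat
  assumes hopf: "graded_connected_hopf_algebra \<Delta> \<epsilon> S H"
    and linear: "linear \<tau>"
    and graded: "\<And>n. \<tau> ` H n \<subseteq> H n"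
    and involution: "\<And>x. \<tau> (\<tau> x) = x"
    and algebra_morphism: "\<And>x y. \<tau> (x * y) = \<tau> x * \<tau> y"
    and coalgebra: "coalgebra_morphism \<Delta> \<tau> \<or> coalgebra_antimorphism \<Delta> \<tau>"
    and even: "even a" "2 \<le> a"
  shows
    "(\<forall>ps. set ps \<subseteq> primitives \<Delta> \<inter> eigenspace \<tau> 1 \<longrightarrow>
        (\<forall>T\<in>{tau_plus \<Delta> \<tau> a, tau_minus \<Delta> \<tau> a}.
            sym_product ps \<in> eigenspace T (real a ^ length ps)) \<and>
        (0 \<notin> set ps \<longrightarrow> sym_product ps \<noteq> 0)) \<and>
     (\<forall>P r. basis_of P (primitives \<Delta> \<inter> eigenspace \<tau> 1) \<and> linear_order_on P r \<longrightarrow>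
        inj_on sym_product (ordered_lists P r) \<and>
        independent (sym_product ` ordered_lists P r) \<and>
        (cocommutative \<Delta> \<longrightarrow>
          (\<forall>T\<in>{tau_plus \<Delta> \<tau> a, tau_minus \<Delta> \<tau> a}.
            (\<forall>k. basis_of (sym_product ` {ps \<in> ordered_lists P r. length ps = k})
                   (eigenspace T (real a ^ k)) \<and>
                 generalised_eigenspace T (real a ^ k) = eigenspace T (real a ^ k)) \<and>
            (\<exists>W. basis_of (sym_product ` ordered_lists P r) W \<and>
                 complementary W (generalised_eigenspace T 0)))))"
proof -
  interpret graded_connected_hopf_algebra \<Delta> \<epsilon> S H by (rule hopf)
  interpret hopf_involution \<Delta> \<epsilon> S H \<tau>
    by (intro hopf_involution.intro hopf_involution_axioms.intro hopf linear involution
        algebra_morphism coalgebra)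
  show ?thesis
  proof (rule conjI; intro allI impI; (elim conjE)?)
    fix ps assume ps: "set ps \<subseteq> inv_primitives"
    show "(\<forall>T\<in>{tau_plus \<Delta> \<tau> a, tau_minus \<Delta> \<tau> a}. sym_product ps \<in> eigenspace T (real a ^ length ps)) \<and>
        (0 \<notin> set ps \<longrightarrow> sym_product ps \<noteq> 0)"
    proof (intro conjI ballI impI)
      fix T assume "T \<in> {tau_plus \<Delta> \<tau> a, tau_minus \<Delta> \<tau> a}"
      then obtain F where "alternating F" "T = multi_op F a" using tau_ops_eq_multi_op by blast
      then show "sym_product ps \<in> eigenspace T (real a ^ length ps)"
        using multi_op_sym_product ps even(2) by blast
    qed (use sym_product_nonzero ps in blast)
  next
    fix P r assume P: "basis_of P inv_primitives" and r: "linear_order_on P r"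
    have "independent P" "P \<subseteq> primitives \<Delta>" "antisym r"
      using P r span_superset[of P]
      by (auto simp: basis_of_def linear_order_on_def partial_order_on_def)
    note ind = sym_product_independent[OF this]
    let ?B = "\<lambda>k. sym_product ` {ps \<in> ordered_lists P r. length ps = k}"
    have union: "(\<Union>k. ?B k) = sym_product ` ordered_lists P r" by auto
    have "(\<forall>k. basis_of (?B k) (eigenspace T (real a ^ k)) \<and>
          generalised_eigenspace T (real a ^ k) = eigenspace T (real a ^ k)) \<and>
        (\<exists>W. basis_of (sym_product ` ordered_lists P r) W \<and>
          complementary W (generalised_eigenspace T 0))"
      if cc: "cocommutative \<Delta>" and T: "T \<in> {tau_plus \<Delta> \<tau> a, tau_minus \<Delta> \<tau> a}" for T
    proof -
      obtain F where F: "alternating F" "T = multi_op F a" using tau_ops_eq_multi_op[OF T] by blast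
      note spec = multi_op_spectrum[OF F(1) even(2,1) cc P r, folded F(2)]
      have "independent (?B k)" for k
        by (rule independent_mono[OF ind(2)]) auto
      then have "\<forall>k. basis_of (?B k) (eigenspace T (real a ^ k)) \<and>
          generalised_eigenspace T (real a ^ k) = eigenspace T (real a ^ k)"
        using spec(1,2) by (simp add: basis_of_def)
      moreover have "basis_of (sym_product ` ordered_lists P r) (span (sym_product ` ordered_lists P r))"
        using ind(2) by (simp add: basis_of_def)
      ultimately show ?thesis using spec(3) unfolding union by blast
    qed
    then show "inj_on sym_product (ordered_lists P r) \<and>
        independent (sym_product ` ordered_lists P r) \<and>
        (cocommutative \<Delta> \<longrightarrow>
          (\<forall>T\<in>{tau_plus \<Delta> \<tau> a, tau_minus \<Delta> \<tau> a}.
            (\<forall>k. basis_of (?B k) (eigenspace T (real a ^ k)) \<and>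
                 generalised_eigenspace T (real a ^ k) = eigenspace T (real a ^ k)) \<and>
            (\<exists>W. basis_of (sym_product ` ordered_lists P r) W \<and>
                 complementary W (generalised_eigenspace T 0))))"
      using ind by blast
  qed
qed

end
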